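(* Let $c_n$ ($n\ge3$) be the number of optimal strategies for Player I in the Penney-Ante game with strings of length $n$. There is a positive constant $\alpha$, with numerical value $\alpha=0.040602\dots$, such that as $n\to\infty$, $$c_n=\begin{cases}\alpha 2^n+O(2^{n/4}) & \text{if } n \text{ is even},\\ \alpha\left(2^n+2^{\lfloor n/2\rfloor+1}\right)+O(2^{n/4}) & \text{if } n \text{ is odd}.\end{cases}$$ In particular $c_n/2^n\to\alpha$.
   Context: Penney-Ante game with strings of length $n\ge3$: Player I chooses a string $A\in\{H,T\}^n$; Player II, seeing $A$, chooses $B\in\{H,T\}^n$, $B\ne A$. A fair coin is tossed repeatedly (independently) and the player whose string first appears as a block of consecutive tosses wins. A string $A$ is an optimal strategy for Player I if it maximizes $\min_{B\ne A}P(A\text{ appears before }B)$ over all $A\in\{H,T\}^n$. $c_n$ is the number of such optimal strings.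
   Formalization: The numerical value α = 0.040602… is replaced by 0.040625 ≤ α < 0.040626, since α is the limit of c_n/2^n, which is 0.0406258…; the printed digits are therefore false. *)

theory Defs
  imports "HOL-Probability.Probability"
begin

text \<open>Coin tosses are booleans, with \<^term>\<open>True\<close> for heads.\<close>

definition fair_tosses :: "bool stream measure" where
  "fair_tosses = stream_space (measure_pmf (bernoulli_pmf (1 / 2)))"

definition occurs_at :: "bool list \<Rightarrow> nat \<Rightarrow> bool stream \<Rightarrow> bool" where
  "occurs_at w i \<omega> \<longleftrightarrow> stake (length w) (sdrop i \<omega>) = w"

text \<open>
  Occurrences are compared by starting position. This is only used for distinct strings of
  equal length, which cannot occur at the same position; comparing starting positions is then
  the same as comparing the times at which the occurrences are completed.
\<close>

definition appears_before :: "bool list \<Rightarrow> bool list \<Rightarrow> bool stream \<Rightarrow> bool" where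
  "appears_before A B \<omega> \<longleftrightarrow> (\<exists>i. occurs_at A i \<omega> \<and> (\<forall>j\<le>i. \<not> occurs_at B j \<omega>))"

definition win_prob :: "bool list \<Rightarrow> bool list \<Rightarrow> real" where
  "win_prob A B = \<P>(\<omega> in fair_tosses. appears_before A B \<omega>)"

definition guaranteed_win_prob :: "bool list \<Rightarrow> real" where
  "guaranteed_win_prob A = Min (win_prob A ` {B. length B = length A \<and> B \<noteq> A})"

definition optimal_strategy :: "nat \<Rightarrow> bool list \<Rightarrow> bool" where
  "optimal_strategy n A \<longleftrightarrow> is_arg_max guaranteed_win_prob (\<lambda>A'. length A' = n) A"

definition num_optimal :: "nat \<Rightarrow> nat" where
  "num_optimal n = card {A. optimal_strategy n A}"

end

theory Submission
  imports Defs "HOL-Library.Sublist"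
begin

text \<open>
  Conway's formula gives the odds of \<open>B\<close> against \<open>A\<close> as \<open>(AA - AB) : (BB - BA)\<close>, where
  \<open>XY\<close> sums \<open>2^(k-1)\<close> over the \<open>k\<close> for which the last \<open>k\<close> letters of \<open>X\<close> are the first \<open>k\<close>
  letters of \<open>Y\<close>. It suffices to answer \<open>A = p c\<close> by \<open>B = x p\<close>. Then \<open>AA - AB - 2 (BB - BA)\<close> is a
  signed sum of powers of two over the borders of \<open>p\<close>, in which the longest border dominates.
  The second player can make it nonnegative, and so win with probability at least 2/3, unless
  \<open>p = a b ... b a\<close> and \<open>c = a\<close> with \<open>b\<close> the other letter and no border of \<open>p\<close> of
  length at least 2. All these exceptional \<open>A\<close> are equally good and hence optimal.
  Classifying the words \<open>a b ... b a\<close> by their shortest border of length at least 2 gives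
  a recurrence for their number, in which only the lengths up to half are involved; this
  yields the density and the error term.
\<close>

section \<open>Conway's formula for the odds\<close>

text \<open>Conway's leading number: the overlaps of X with Y read as binary digits. For X = Y it
  encodes the autocorrelation.\<close>

definition conway :: "'a list \<Rightarrow> 'a list \<Rightarrow> int" where
  "conway X Y =
    (\<Sum>k = 1..length X. of_bool (drop (length X - k) X = take k Y) * 2 ^ (k - 1))"

definition hit :: "'a list set \<Rightarrow> 'a list \<Rightarrow> bool" where
  "hit P w \<longleftrightarrow> (\<exists>X\<in>P. suffix X w)"

text \<open>Testing \<open>hit\<close> on every prefix of w turns a statement about suffixes into
  the absence of any occurrence inside w: the game is still undecided.\<close>

definition avoiding :: "'a list set \<Rightarrow> nat \<Rightarrow> 'a list set" where
  "avoiding P t = {w. length w = t \<and> (\<forall>p. prefix p w \<longrightarrow> \<not> hit P p)}"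

text \<open>Only strict prefixes are free of hits, so the game is decided exactly at the last
  letter, in favour of X.\<close>

definition first_hits :: "'a list set \<Rightarrow> 'a list \<Rightarrow> nat \<Rightarrow> 'a list set" where
  "first_hits P X t = {w. length w = t \<and> suffix X w \<and> (\<forall>p. strict_prefix p w \<longrightarrow> \<not> hit P p)}"

lemma finite_avoiding [simp]: "finite (avoiding P t :: 'a :: finite list set)"
  by (rule finite_subset[OF _ finite_lists_length_eq[of UNIV t]]) (auto simp: avoiding_def)

lemma finite_first_hits [simp]: "finite (first_hits P X t :: 'a :: finite list set)"
  by (rule finite_subset[OF _ finite_lists_length_eq[of UNIV t]]) (auto simp: first_hits_def)

lemma first_hits_eq_empty: "t < length X \<Longrightarrow> first_hits P X t = {}"
  by (auto simp: first_hits_def dest: suffix_length_le)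

lemma strict_prefix_snoc_iff: "strict_prefix p (w @ [c]) \<longleftrightarrow> prefix p w"
  by (auto simp: strict_prefix_def)

lemma suffix_eq_length: "suffix X w \<Longrightarrow> suffix Y w \<Longrightarrow> length X = length Y \<Longrightarrow> X = Y"
  by (auto simp: suffix_def)

section \<open>Counting undecided and decided words by length\<close>

locale two_words =
  fixes A B :: "bool list" and n :: nat
  assumes length_A: "length A = n" and length_B: "length B = n"
    and A_neq_B: "A \<noteq> B"
begin

abbreviation "S \<equiv> avoiding {A, B}"
abbreviation "F \<equiv> first_hits {A, B}"

lemma n_pos: "n > 0"
  using length_A length_B A_neq_B by (cases n) auto

lemma length_in: "X \<in> {A, B} \<Longrightarrow> length X = n"
  using length_A length_B by auto

text \<open>Each of the two one-letter extensions of an undecided word is undecided, decided for A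
  or decided for B. Two distinct words of equal length cannot both be suffixes, so the cases exclude
  one another.\<close>

lemma card_step: "2 * card (S t) = card (S (Suc t)) + card (F A (Suc t)) + card (F B (Suc t))"
proof -
  define D where "D = (\<lambda>(w, c :: bool). w @ [c]) ` (S t \<times> UNIV)"
  have inD: "v \<in> D \<longleftrightarrow> length v = Suc t \<and> (\<forall>p. strict_prefix p v \<longrightarrow> \<not> hit {A, B} p)" for v
    by (cases v rule: rev_cases) (auto simp: D_def avoiding_def strict_prefix_snoc_iff)
  have "card D = card (S t \<times> (UNIV :: bool set))"
    unfolding D_def by (rule card_image) (auto simp: inj_on_def)
  also have "\<dots> = 2 * card (S t)"
    by (simp add: card_cartesian_product)
  finally have "card D = 2 * card (S t)" .
  moreover have "D = (S (Suc t) \<union> F A (Suc t)) \<union> F B (Suc t)"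
  proof (intro set_eqI)
    fix v
    show "v \<in> D \<longleftrightarrow> v \<in> (S (Suc t) \<union> F A (Suc t)) \<union> F B (Suc t)"
      unfolding inD by (auto simp: avoiding_def first_hits_def hit_def strict_prefix_def)
  qed
  moreover have "S (Suc t) \<inter> F A (Suc t) = {}"
    by (auto simp: avoiding_def first_hits_def hit_def)
  moreover have "(S (Suc t) \<union> F A (Suc t)) \<inter> F B (Suc t) = {}"
    using A_neq_B length_A length_B suffix_eq_length[of A _ B]
    by (fastforce simp: avoiding_def first_hits_def hit_def)
  ultimately show ?thesis
    by (metis card_Un_disjoint finite_UnI finite_avoiding finite_first_hits)
qed

text \<open>
  Appending \<open>Z\<close> to a word that avoids both strings ends the game after some \<open>k \<le> n\<close> further
  letters, with a string \<open>X\<close> whose last \<open>k\<close> letters are the first \<open>k\<close> letters of \<open>Z\<close>.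
\<close>

lemma card_avoiding:
  assumes Z: "Z \<in> {A, B}"
  shows "card (S t) =
    (\<Sum>k = 1..n. \<Sum>X\<in>{A, B}. of_bool (drop (n - k) X = take k Z) * card (F X (t + k)))"
proof -
  \<comment> \<open>\<open>E (k, X)\<close> holds the undecided w for which feeding Z letter by
    letter ends the game with X after exactly k letters. These classes partition
    \<open>S t\<close>.\<close>
  define E where "E = (\<lambda>(k, X). {w \<in> S t. w @ take k Z \<in> F X (t + k)})"
  have lZ: "length Z = n"
    using length_in[OF Z] .
  have "S t \<subseteq> \<Union> (E ` ({1..n} \<times> {A, B}))"
  proof
    fix w assume w: "w \<in> S t"
    define k where "k = (LEAST k. hit {A, B} (w @ take k Z))"
    have "hit {A, B} (w @ take n Z)"
      using Z lZ by (auto simp: hit_def suffix_def)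
    hence k: "hit {A, B} (w @ take k Z)" and kn: "k \<le> n" and
      least: "\<And>j. j < k \<Longrightarrow> \<not> hit {A, B} (w @ take j Z)"
      unfolding k_def by (auto intro: LeastI Least_le dest: not_less_Least)
    have "k \<noteq> 0"
      using k w by (intro notI) (simp add: avoiding_def)
    obtain X where X: "X \<in> {A, B}" "suffix X (w @ take k Z)"
      using k by (auto simp: hit_def)
    have "\<not> hit {A, B} p" if p: "strict_prefix p (w @ take k Z)" for p
    proof (cases "prefix p w")
      case True
      thus ?thesis using w by (auto simp: avoiding_def)
    next
      case False
      then obtain r where r: "p = w @ r" "strict_prefix r (take k Z)"
        using p by (auto simp: strict_prefix_def prefix_append)
      have "length r < k"
        using prefix_length_less[OF r(2)] by simp
      moreover have "r = take (length r) Z"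
        using r(2) \<open>length r < k\<close>
        by (metis append_eq_conv_conj min.absorb1 nat_less_le prefix_def strict_prefix_def take_take)
      ultimately show ?thesis using least r(1) by metis
    qed
    hence "w \<in> E (k, X)"
      using w X kn lZ by (auto simp: E_def first_hits_def avoiding_def)
    thus "w \<in> \<Union> (E ` ({1..n} \<times> {A, B}))"
      using \<open>k \<noteq> 0\<close> kn X by (intro UN_I[of "(k, X)"]) auto
  qed
  hence "S t = \<Union> (E ` ({1..n} \<times> {A, B}))"
    by (auto simp: E_def)
  also have "card \<dots> = (\<Sum>i\<in>{1..n} \<times> {A, B}. card (E i))"
  proof (rule card_UN_disjoint)
    show "\<forall>i\<in>{1..n} \<times> {A, B}. finite (E i)"
      by (auto simp: E_def)
    have no: False if "w \<in> E (k, X)" "w \<in> E (l, Y)" "k < l" "l \<le> n" "X \<in> {A, B}" for w k l X Y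
    proof -
      have "strict_prefix (w @ take k Z) (w @ take l Z)"
        using that lZ take_add[of k "l - k" Z] by (auto simp: strict_prefix_def)
      hence "\<not> hit {A, B} (w @ take k Z)"
        using that by (auto simp: E_def first_hits_def)
      thus False using that by (auto simp: E_def first_hits_def hit_def)
    qed
    have no': "X = Y" if "w \<in> E (k, X)" "w \<in> E (k, Y)" "X \<in> {A, B}" "Y \<in> {A, B}" for w k X Y
      using that length_in by (auto simp: E_def first_hits_def dest: suffix_eq_length)
    show "\<forall>i\<in>{1..n} \<times> {A, B}. \<forall>j\<in>{1..n} \<times> {A, B}. i \<noteq> j \<longrightarrow> E i \<inter> E j = {}"
    proof (intro ballI impI equals0I, elim IntE)
      fix i j w
      assume ij: "i \<in> {1..n} \<times> {A, B}" "j \<in> {1..n} \<times> {A, B}" "i \<noteq> j" and w: "w \<in> E i" "w \<in> E j"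
      obtain k X l Y where [simp]: "i = (k, X)" "j = (l, Y)" by (cases i, cases j)
      show False
        using no[of w k X l Y] no[of w l Y k X] no'[of w k X Y] ij w
        by (cases k l rule: linorder_cases) auto
    qed
  qed simp
  also have "\<dots> = (\<Sum>k = 1..n. \<Sum>X\<in>{A, B}. card (E (k, X)))"
    by (simp add: sum.cartesian_product)
  also have "\<dots> = (\<Sum>k = 1..n. \<Sum>X\<in>{A, B}. of_bool (drop (n - k) X = take k Z) * card (F X (t + k)))"
  proof (intro sum.cong refl)
    fix k X assume k: "k \<in> {1..n}" and X: "X \<in> {A, B}"
    have lX: "length X = n" using length_in[OF X] .
    \<comment> \<open>The last k letters of a word ending in X are those of X. If they agree with
      \<open>take k Z\<close>, deleting them inverts the append map; if not, the class is
      empty.\<close>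
    have last_k: "drop t v = drop (n - k) X" if v: "v \<in> F X (t + k)" for v
    proof -
      obtain u where u: "v = u @ X" "length v = t + k"
        using v by (auto simp: first_hits_def suffix_def)
      have "length u + n = t + k" using u lX by auto
      hence "t = length u + (n - k)" using k by auto
      thus ?thesis using u by simp
    qed
    show "card (E (k, X)) = of_bool (drop (n - k) X = take k Z) * card (F X (t + k))"
    proof (cases "drop (n - k) X = take k Z")
      case True
      have "bij_betw (\<lambda>w. w @ take k Z) (E (k, X)) (F X (t + k))"
      proof (rule bij_betw_imageI)
        show "(\<lambda>w. w @ take k Z) ` E (k, X) = F X (t + k)"
        proof (intro equalityI subsetI)
          fix v assume v: "v \<in> F X (t + k)"
          have eq: "v = take t v @ take k Z"
            using last_k[OF v] True by (metis append_take_drop_id)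
          have lv: "length v = t + k" using v by (auto simp: first_hits_def)
          have "\<not> hit {A, B} p" if "prefix p (take t v)" for p
          proof -
            have "length p < length v"
              using prefix_length_le[OF that] k lv by auto
            moreover have "prefix p v"
              using that take_is_prefix prefix_order.trans by blast
            ultimately show ?thesis
              using v by (auto simp: first_hits_def strict_prefix_def)
          qed
          hence "take t v \<in> E (k, X)"
            using v eq lv by (auto simp: E_def avoiding_def)
          thus "v \<in> (\<lambda>w. w @ take k Z) ` E (k, X)"
            using eq by blast
        qed (auto simp: E_def)
      qed (auto simp: inj_on_def)
      thus ?thesis using True by (simp add: bij_betw_same_card)
    next
      case False
      have "E (k, X) = {}"
      proof (intro equals0I)
        fix w assume w: "w \<in> E (k, X)"
        hence "drop t (w @ take k Z) = drop (n - k) X" and "length w = t"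
          using last_k[of "w @ take k Z"] by (auto simp: E_def avoiding_def)
        thus False using False by simp
      qed
      thus ?thesis using False by simp
    qed
  qed
  finally show ?thesis .
qed

end

section \<open>From counts to first-occurrence probabilities\<close>

context two_words
begin

text \<open>A word of length t has probability 2^(-t), so this is the chance that X comes first; for
  X = A, \<open>win_prob_eq\<close> makes the link to the measure.\<close>

definition first_prob :: "bool list \<Rightarrow> real" where
  "first_prob X = (\<Sum>t. real (card (F X t)) / 2 ^ t)"

text \<open>Conservation of mass: after division by 2^(t+1), \<open>card_step\<close> says that the
  undecided mass splits into decided and still undecided mass. At t = 0 only the empty word is
  present.\<close>

lemma partial_sums:
  "(\<Sum>i\<le>t. real (card (F A i)) / 2 ^ i + real (card (F B i)) / 2 ^ i) + real (card (S t)) / 2 ^ t = 1"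
proof (induction t)
  case 0
  have "S 0 = {[]}"
    using n_pos length_A length_B by (auto simp: avoiding_def hit_def)
  moreover have "F A 0 = {}" "F B 0 = {}"
    using n_pos length_A length_B by (simp_all add: first_hits_eq_empty)
  ultimately show ?case by simp
next
  case (Suc t)
  have "real (card (S t)) / 2 ^ t = real (2 * card (S t)) / 2 ^ Suc t"
    by simp
  also have "\<dots> = real (card (S (Suc t))) / 2 ^ Suc t + real (card (F A (Suc t))) / 2 ^ Suc t
      + real (card (F B (Suc t))) / 2 ^ Suc t"
    unfolding card_step by (simp add: add_divide_distrib)
  finally show ?case using Suc.IH by simp
qed

lemma first_prob_sums:
  assumes "X \<in> {A, B}"
  shows "(\<lambda>t. real (card (F X t)) / 2 ^ t) sums first_prob X"
proof -
  have "summable (\<lambda>t. real (card (F X t)) / 2 ^ t)"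
  proof (rule summableI_nonneg_bounded)
    fix t
    have "(\<Sum>i<t. real (card (F X i)) / 2 ^ i) \<le> (\<Sum>i\<le>t. real (card (F X i)) / 2 ^ i)"
      by (rule sum_mono2) auto
    also have "\<dots> \<le> (\<Sum>i\<le>t. real (card (F A i)) / 2 ^ i + real (card (F B i)) / 2 ^ i)"
      using assms by (intro sum_mono) auto
    also have "\<dots> \<le> 1"
      using partial_sums[of t] by (smt (verit) divide_nonneg_nonneg of_nat_0_le_iff zero_le_power)
    finally show "(\<Sum>i<t. real (card (F X i)) / 2 ^ i) \<le> 1" .
  qed auto
  thus ?thesis by (simp add: first_prob_def summable_sums)
qed

text \<open>Sum \<open>card_avoiding\<close> over t with weight 2^(-t). The term for k is 2^k times
  the series of X shifted by k, and the shift loses nothing because no word shorter than n ends in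
  X. The sum of 2^k over the overlaps is twice Conway's number. The left side, the expected duration
  of the game, does not depend on Z.\<close>

lemma survival_sums:
  assumes Z: "Z \<in> {A, B}"
  shows "(\<lambda>t. real (card (S t)) / 2 ^ t) sums (\<Sum>X\<in>{A, B}. 2 * real_of_int (conway X Z) * first_prob X)"
proof -
  let ?f = "\<lambda>X t. real (card (F X t)) / 2 ^ t"
  let ?o = "\<lambda>X k. of_bool (drop (n - k) X = take k Z)"
  have shift: "(\<lambda>t. ?f X (t + k)) sums first_prob X" if "k \<in> {1..n}" "X \<in> {A, B}" for X k
  proof -
    have "?f X i = 0" if "i < k" for i
      using that \<open>k \<in> _\<close> length_in[OF \<open>X \<in> _\<close>] by (simp add: first_hits_eq_empty)
    thus ?thesis
      using sums_split_initial_segment[OF first_prob_sums[OF that(2)], of k] by simp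
  qed
  have "(\<lambda>t. \<Sum>k = 1..n. \<Sum>X\<in>{A, B}. ?o X k * 2 ^ k * ?f X (t + k)) sums
      (\<Sum>k = 1..n. \<Sum>X\<in>{A, B}. ?o X k * 2 ^ k * first_prob X)"
    by (intro sums_sum sums_mult shift)
  also have "(\<lambda>t. \<Sum>k = 1..n. \<Sum>X\<in>{A, B}. ?o X k * 2 ^ k * ?f X (t + k)) =
      (\<lambda>t. real (card (S t)) / 2 ^ t)"
    unfolding card_avoiding[OF Z] of_nat_sum sum_divide_distrib
    by (intro ext sum.cong refl) (simp add: power_add)
  also have "(\<Sum>k = 1..n. \<Sum>X\<in>{A, B}. ?o X k * 2 ^ k * first_prob X) =
      (\<Sum>X\<in>{A, B}. \<Sum>k = 1..n. ?o X k * 2 ^ k * first_prob X)"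
    by (rule sum.swap)
  also have "\<dots> = (\<Sum>X\<in>{A, B}. 2 * real_of_int (conway X Z) * first_prob X)"
  proof (intro sum.cong refl)
    fix X assume X: "X \<in> {A, B}"
    have "2 * real_of_int (conway X Z) = (\<Sum>k = 1..n. ?o X k * (2 * 2 ^ (k - 1)))"
      unfolding conway_def length_in[OF X] of_int_sum sum_distrib_left
      by (intro sum.cong refl) simp
    also have "\<dots> = (\<Sum>k = 1..n. ?o X k * 2 ^ k)"
      by (intro sum.cong refl) (auto simp flip: power_Suc)
    finally show "(\<Sum>k = 1..n. ?o X k * 2 ^ k * first_prob X) =
        2 * real_of_int (conway X Z) * first_prob X"
      by (simp add: sum_distrib_right del: sum_of_bool_mult_eq sum_mult_of_bool_eq)
  qed
  finally show ?thesis .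
qed

text \<open>The expected duration is computed once with Z = A and once with Z = B, and the two
  results are equated.\<close>

lemma conway_balance:
  "(conway A A - conway A B) * first_prob A = (conway B B - conway B A) * first_prob B"
proof -
  have "(\<Sum>X\<in>{A, B}. 2 * real_of_int (conway X A) * first_prob X) =
      (\<Sum>X\<in>{A, B}. 2 * real_of_int (conway X B) * first_prob X)"
    using survival_sums[of A] survival_sums[of B] sums_unique2 by blast
  thus ?thesis using A_neq_B by (simp add: algebra_simps)
qed

text \<open>The survival series converges, so its terms vanish in the limit and by
  \<open>partial_sums\<close> no mass remains undecided.\<close>

lemma first_prob_add: "first_prob A + first_prob B = 1"
proof -
  have "(\<lambda>t. real (card (S t)) / 2 ^ t) \<longlonglongrightarrow> 0"
    using survival_sums[of A] by (simp add: sums_iff summable_LIMSEQ_zero)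
  moreover have "(\<lambda>t. \<Sum>i\<le>t. real (card (F A i)) / 2 ^ i + real (card (F B i)) / 2 ^ i)
      \<longlonglongrightarrow> first_prob A + first_prob B"
    using sums_add[OF first_prob_sums first_prob_sums, of A B] by (simp add: sums_def_le)
  ultimately have "(\<lambda>t. (\<Sum>i\<le>t. real (card (F A i)) / 2 ^ i + real (card (F B i)) / 2 ^ i)
      + real (card (S t)) / 2 ^ t) \<longlonglongrightarrow> first_prob A + first_prob B + 0"
    by (intro tendsto_add)
  thus ?thesis
    unfolding partial_sums by (simp add: LIMSEQ_const_iff)
qed

end

section \<open>Finite prefixes under the measure on toss sequences\<close>

lemma sets_fair_tosses: "sets fair_tosses = sets (stream_space (count_space UNIV))"
  unfolding fair_tosses_def by (rule sets_stream_space_cong) simp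

lemma space_fair_tosses [simp]: "space fair_tosses = UNIV"
  by (simp add: fair_tosses_def space_stream_space)

lemma stake_measurable [measurable]: "stake t \<in> fair_tosses \<rightarrow>\<^sub>M count_space UNIV"
  using measurable_stake measurable_cong_sets[OF sets_fair_tosses refl] by blast

lemma prob_space_fair_tosses: "prob_space fair_tosses"
  unfolding fair_tosses_def by (rule prob_space.prob_space_stream_space) (rule prob_space_measure_pmf)

lemma emeasure_stake_eq: "emeasure fair_tosses {\<omega>. stake (length w) \<omega> = w} = (1 / 2) ^ length w"
proof (induction w)
  case Nil
  show ?case using prob_space.emeasure_space_1[OF prob_space_fair_tosses] by simp
next
  case (Cons a w)
  let ?M = "measure_pmf (bernoulli_pmf (1 / 2))"
  let ?X = "{\<omega>. stake (length (a # w)) \<omega> = a # w}"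
  have meas: "?X \<in> sets fair_tosses"
    using measurable_sets[OF stake_measurable[of "length (a # w)"], of "{a # w}"]
    by (simp add: vimage_def)
  have "emeasure fair_tosses ?X =
      (\<integral>\<^sup>+b. emeasure fair_tosses {\<omega> \<in> space fair_tosses. b ## \<omega> \<in> ?X} \<partial>?M)"
    using meas unfolding fair_tosses_def
    by (intro prob_space.emeasure_stream_space prob_space_measure_pmf)
  also have "\<dots> = (\<integral>\<^sup>+b. (1 / 2) ^ length w * indicator {a} b \<partial>?M)"
  proof (rule nn_integral_cong)
    fix b
    show "emeasure fair_tosses {\<omega> \<in> space fair_tosses. b ## \<omega> \<in> ?X} =
        (1 / 2) ^ length w * indicator {a} b"
      using Cons.IH by (cases "b = a") auto
  qed
  also have "\<dots> = (1 / 2) ^ length w * emeasure ?M {a}"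
    by (rule nn_integral_cmult_indicator) simp
  also have "emeasure ?M {a} = 1 / 2"
    by (cases a) (simp_all add: emeasure_pmf_single ennreal_divide_numeral flip: ennreal_1)
  finally show ?case by (simp add: mult.commute)
qed

lemma measure_stake_in:
  assumes "W \<subseteq> {w. length w = t}"
  shows "measure fair_tosses {\<omega>. stake t \<omega> \<in> W} = real (card W) / 2 ^ t"
proof -
  interpret prob_space fair_tosses by (rule prob_space_fair_tosses)
  have fin: "finite W"
    using finite_subset[OF assms] finite_lists_length_eq[of "UNIV :: bool set" t] by simp
  have "measure fair_tosses {\<omega>. stake t \<omega> = w} = 1 / 2 ^ t" if "w \<in> W" for w
  proof -
    have "length w = t" using that assms by auto
    moreover have "((1::ennreal) / 2) ^ t = ennreal (1 / 2 ^ t)"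
      by (metis ennreal_1 ennreal_divide_numeral ennreal_power power_one_over zero_le_divide_1_iff 
          zero_le_numeral zero_le_one)
    ultimately show ?thesis
      using emeasure_stake_eq[of w] by (simp add: measure_def)
  qed
  moreover have "{\<omega>. stake t \<omega> \<in> W} = (\<Union>w\<in>W. {\<omega>. stake t \<omega> = w})"
    by auto
  moreover have "measure fair_tosses (\<Union>w\<in>W. {\<omega>. stake t \<omega> = w}) =
      (\<Sum>w\<in>W. measure fair_tosses {\<omega>. stake t \<omega> = w})"
  proof (rule finite_measure_finite_Union)
    show "(\<lambda>w. {\<omega>. stake t \<omega> = w}) ` W \<subseteq> sets fair_tosses"
      using measurable_sets[OF stake_measurable[of t], of "{w}" for w] by (auto simp: vimage_def)
  qed (auto simp: fin disjoint_family_on_def)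
  ultimately show ?thesis by simp
qed

lemma suffix_stake_iff:
  "suffix X (stake l \<omega>) \<longleftrightarrow> length X \<le> l \<and> occurs_at X (l - length X) \<omega>"
proof -
  have "suffix X (stake l \<omega>) \<longleftrightarrow> length X \<le> l \<and> drop (l - length X) (stake l \<omega>) = X"
    by (metis append_eq_conv_conj append_take_drop_id length_stake suffix_drop suffix_length_le suffix_take)
  also have "\<dots> \<longleftrightarrow> length X \<le> l \<and> occurs_at X (l - length X) \<omega>"
    by (auto simp: occurs_at_def drop_stake)
  finally show ?thesis .
qed

lemma strict_prefix_stake_iff: "strict_prefix p (stake t \<omega>) \<longleftrightarrow> (\<exists>l<t. p = stake l \<omega>)"
proof
  assume p: "strict_prefix p (stake t \<omega>)"
  have "p = take (length p) (stake t \<omega>)"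
    using p by (metis append_eq_conv_conj prefix_def strict_prefix_def)
  moreover have "length p < t"
    using prefix_length_less[OF p] by simp
  ultimately show "\<exists>l<t. p = stake l \<omega>"
    by (metis take_stake min.absorb1 less_imp_le)
next
  assume "\<exists>l<t. p = stake l \<omega>"
  then obtain l where l: "l < t" "p = stake l \<omega>" by blast
  have "stake t \<omega> = p @ stake (t - l) (sdrop l \<omega>)"
    using l by simp
  thus "strict_prefix p (stake t \<omega>)"
    using l by (metis length_stake nat_neq_iff prefixI strict_prefix_def)
qed

context two_words
begin

text \<open>Starting and finishing positions differ by the constant n. The witness in
  \<open>appears_before\<close> may be a later occurrence of A, so the proof passes to the least
  one.\<close>

lemma appears_before_iff: "appears_before A B \<omega> \<longleftrightarrow> (\<exists>t. stake t \<omega> \<in> F A t)"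
proof
  assume "appears_before A B \<omega>"
  then obtain i where i: "occurs_at A i \<omega>" "\<And>j. j \<le> i \<Longrightarrow> \<not> occurs_at B j \<omega>"
    by (auto simp: appears_before_def)
  define i0 where "i0 = (LEAST i. occurs_at A i \<omega>)"
  have i0: "occurs_at A i0 \<omega>" "i0 \<le> i" "\<And>j. j < i0 \<Longrightarrow> \<not> occurs_at A j \<omega>"
    using i(1) unfolding i0_def by (auto intro: LeastI Least_le dest: not_less_Least)
  have "\<not> hit {A, B} (stake l \<omega>)" if "l < i0 + n" for l
  proof
    assume "hit {A, B} (stake l \<omega>)"
    hence "n \<le> l" "occurs_at A (l - n) \<omega> \<or> occurs_at B (l - n) \<omega>"
      using length_A length_B by (auto simp: hit_def suffix_stake_iff)
    thus False using i(2)[of "l - n"] i0(2) i0(3)[of "l - n"] that by auto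
  qed
  hence "stake (i0 + n) \<omega> \<in> F A (i0 + n)"
    using i0(1) length_A by (auto simp: first_hits_def suffix_stake_iff strict_prefix_stake_iff)
  thus "\<exists>t. stake t \<omega> \<in> F A t" by blast
next
  assume "\<exists>t. stake t \<omega> \<in> F A t"
  then obtain t where t: "n \<le> t" "occurs_at A (t - n) \<omega>" "\<And>l. l < t \<Longrightarrow> \<not> hit {A, B} (stake l \<omega>)"
    using length_A by (auto simp: first_hits_def suffix_stake_iff strict_prefix_stake_iff)
  have "\<not> occurs_at B j \<omega>" if "j \<le> t - n" for j
  proof
    assume B: "occurs_at B j \<omega>"
    hence "j \<noteq> t - n"
      using t(2) A_neq_B length_A length_B by (auto simp: occurs_at_def)
    hence "j + n < t" using that t(1) by auto
    thus False using t(3)[of "j + n"] B length_B by (auto simp: hit_def suffix_stake_iff)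
  qed
  thus "appears_before A B \<omega>"
    using t(2) by (auto simp: appears_before_def)
qed

text \<open>The events of being decided for A at time t are disjoint, since a decided prefix cannot
  be a strict prefix of a first hit; countable additivity gives the series.\<close>

lemma win_prob_eq: "win_prob A B = first_prob A"
proof -
  interpret prob_space fair_tosses by (rule prob_space_fair_tosses)
  let ?E = "\<lambda>t. {\<omega>. stake t \<omega> \<in> F A t}"
  have "(\<lambda>t. measure fair_tosses (?E t)) sums measure fair_tosses (\<Union>t. ?E t)"
  proof (rule finite_measure_UNION)
    show "range ?E \<subseteq> sets fair_tosses"
      using measurable_sets[OF stake_measurable] by (auto simp: vimage_def)
    have "\<omega> \<notin> ?E l" if "\<omega> \<in> ?E t" "l < t" for \<omega> l t
      using that by (auto simp: first_hits_def strict_prefix_stake_iff hit_def)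
    thus "disjoint_family ?E"
      by (fastforce simp: disjoint_family_on_def neq_iff)
  qed
  moreover have "measure fair_tosses (?E t) = real (card (F A t)) / 2 ^ t" for t
    by (rule measure_stake_in) (auto simp: first_hits_def)
  moreover have "win_prob A B = measure fair_tosses (\<Union>t. ?E t)"
    unfolding win_prob_def by (rule arg_cong[where f = "measure fair_tosses"]) (auto simp: appears_before_iff)
  ultimately have "(\<lambda>t. real (card (F A t)) / 2 ^ t) sums win_prob A B"
    by simp
  thus ?thesis using first_prob_sums[of A] sums_unique2 by blast
qed

end

text \<open>The odds (BB - BA) : (AA - AB) of A against B in cross-multiplied form; the signs of the
  two factors are settled where the odds are used.\<close>

theorem conway_odds:
  assumes "length A = length B" "A \<noteq> B"
  shows "(conway A A - conway A B) * win_prob A B = (conway B B - conway B A) * (1 - win_prob A B)"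
proof -
  interpret two_words A B "length A"
    using assms by unfold_locales auto
  show ?thesis
    using conway_balance first_prob_add win_prob_eq by (metis add_diff_cancel_left')
qed

section \<open>Optimal strings\<close>

text \<open>The length 0 and every j from \<open>length p\<close> on satisfy this trivially, so
  proper borders are obtained by bounding j below the length.\<close>

definition border :: "'a list \<Rightarrow> nat \<Rightarrow> bool" where
  "border p j \<longleftrightarrow> drop (length p - j) p = take j p"

text \<open>The exceptional words a b ... b a. Equal first and last letters force a border of length
  1, hence the exclusion starts at 2. For m = 3 the two inner positions coincide.\<close>

definition tame :: "'a \<Rightarrow> nat \<Rightarrow> 'a list set" where
  "tame a m = {p. length p = m \<and> 3 \<le> m \<and> p ! 0 = a \<and> p ! 1 \<noteq> a \<and> p ! (m - 2) \<noteq> a \<and> p ! (m - 1) = a \<and>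
    (\<forall>j. 2 \<le> j \<longrightarrow> j < m \<longrightarrow> \<not> border p j)}"

lemma border_0 [simp]: "border p 0"
  by (simp add: border_def)

lemma conway_Suc:
  assumes "length X = Suc m"
  shows "conway X Y = (\<Sum>i\<le>m. of_bool (drop (m - i) X = take (Suc i) Y) * 2 ^ i)"
proof -
  have "conway X Y = (\<Sum>i\<in>{..m}. of_bool (drop (Suc m - Suc i) X = take (Suc i) Y) * 2 ^ (Suc i - 1))"
    unfolding conway_def assms by (rule sum.reindex_bij_witness[of _ Suc "\<lambda>k. k - 1"]) auto
  thus ?thesis by simp
qed

lemma conway_nonneg: "0 \<le> conway X Y"
  by (simp add: conway_def sum_nonneg)

lemma sum_of_bool_power_le:
  "(\<Sum>i<m. of_bool (Q i) * 2 ^ i) \<le> (2::int) ^ m - 1"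
proof -
  have "(\<Sum>i<m. of_bool (Q i) * 2 ^ i) \<le> (\<Sum>i<m. (2::int) ^ i)"
    by (intro sum_mono) simp
  thus ?thesis using power_diff_1_eq[of "2::int" m] by simp
qed

lemma conway_self_ge:
  assumes "length X = Suc m"
  shows "2 ^ m \<le> conway X X"
proof -
  have "conway X X = (\<Sum>i<m. of_bool (drop (m - i) X = take (Suc i) X) * 2 ^ i) + 2 ^ m"
    unfolding conway_Suc[OF assms] using assms by (simp flip: lessThan_Suc_atMost)
  thus ?thesis by (simp add: sum_nonneg)
qed

text \<open>Distinct words of equal length lack the full overlap, so the top bit is off. Together
  with \<open>conway_self_ge\<close>, this makes both of Conway's differences positive.\<close>

lemma conway_distinct_less:
  assumes "length X = Suc m" "length Y = Suc m" "X \<noteq> Y"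
  shows "conway X Y < 2 ^ m"
proof -
  have "conway X Y = (\<Sum>i<m. of_bool (drop (m - i) X = take (Suc i) Y) * 2 ^ i)"
    unfolding conway_Suc[OF assms(1)] using assms by (simp flip: lessThan_Suc_atMost)
  thus ?thesis using sum_of_bool_power_le[of "\<lambda>i. drop (m - i) X = take (Suc i) Y" m] by simp
qed

section \<open>Leading numbers of p c and x p in terms of the borders of p\<close>

context
  fixes p :: "'a list" and m :: nat
  assumes lp: "length p = m"
begin

lemma conway_snoc_self:
  "conway (p @ [c]) (p @ [c]) = 2 ^ m + (\<Sum>i<m. of_bool (border p i \<and> p ! i = c) * 2 ^ i)"
proof -
  have "drop (m - i) (p @ [c]) = take (Suc i) (p @ [c]) \<longleftrightarrow> border p i \<and> p ! i = c" if "i < m" for i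
    using that lp by (auto simp: border_def take_Suc_conv_app_nth)
  thus ?thesis
    using lp by (simp add: conway_Suc[of _ m] flip: lessThan_Suc_atMost)
qed

text \<open>An overlap of i + 2 letters reads x, a border of length i, c. So x must precede the
  suffix copy of the border, at position m - 1 - i, and c must follow the prefix copy, at position
  i. The overlap of one letter is the case c = x.\<close>

lemma conway_snoc_Cons:
  "conway (p @ [c]) (x # p) = of_bool (c = x) +
    (\<Sum>i<m. of_bool (border p i \<and> p ! i = c \<and> p ! (m - 1 - i) = x) * 2 ^ Suc i)"
proof -
  have "drop (m - Suc i) (p @ [c]) = take (Suc (Suc i)) (x # p) \<longleftrightarrow>
      border p i \<and> p ! i = c \<and> p ! (m - 1 - i) = x" if "i < m" for i
  proof -
    have "drop (m - Suc i) p = p ! (m - Suc i) # drop (m - i) p"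
      using that lp Cons_nth_drop_Suc[of "m - Suc i" p] by (simp add: Suc_diff_Suc)
    thus ?thesis using that lp by (auto simp: border_def take_Suc_conv_app_nth)
  qed
  thus ?thesis
    using lp by (simp add: conway_Suc[of _ m] sum.atMost_shift del: sum_of_bool_mult_eq)
qed

lemma conway_Cons_self:
  "conway (x # p) (x # p) = 2 ^ m + (\<Sum>i<m. of_bool (border p i \<and> p ! (m - 1 - i) = x) * 2 ^ i)"
proof -
  have "drop (m - i) (x # p) = take (Suc i) (x # p) \<longleftrightarrow> border p i \<and> p ! (m - 1 - i) = x" if "i < m" for i
  proof -
    have "drop (m - i) (x # p) = p ! (m - Suc i) # drop (m - i) p"
      using that lp Cons_nth_drop_Suc[of "m - Suc i" p] by (simp add: Suc_diff_Suc drop_Cons')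
    thus ?thesis using that lp by (auto simp: border_def)
  qed
  thus ?thesis
    using lp by (simp add: conway_Suc[of _ m] flip: lessThan_Suc_atMost)
qed

text \<open>Here an overlap of i + 1 letters is a border of p of that length. Doubling aligns the
  weights with border lengths; the border 0 is then missing, whence -1, and the full border m gives
  2^m.\<close>

lemma conway_Cons_snoc:
  assumes "x # p \<noteq> p @ [c]"
  shows "2 * conway (x # p) (p @ [c]) = 2 ^ m - 1 + (\<Sum>i<m. of_bool (border p i) * 2 ^ i)"
proof -
  have "drop (m - i) (x # p) = take (Suc i) (p @ [c]) \<longleftrightarrow> border p (Suc i)" if "i < m" for i
    using that lp by (auto simp: border_def drop_Cons')
  hence "2 * conway (x # p) (p @ [c]) = (\<Sum>i<m. of_bool (border p (Suc i)) * 2 ^ Suc i)"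
    using lp assms
    by (simp add: conway_Suc[of _ m] sum_distrib_left mult.left_commute
        del: sum_of_bool_mult_eq sum_mult_of_bool_eq flip: lessThan_Suc_atMost)
  also have "\<dots> = (\<Sum>i<Suc m. of_bool (border p i) * 2 ^ i) - 1"
    by (simp add: sum.lessThan_Suc_shift del: sum.lessThan_Suc sum_of_bool_mult_eq)
  also have "\<dots> = 2 ^ m - 1 + (\<Sum>i<m. of_bool (border p i) * 2 ^ i)"
    using lp by (simp add: border_def)
  finally show ?thesis .
qed

text \<open>Contribution of the border of length i to the difference in
  \<open>conway_excess\<close>. Its size depends on c, its sign on x, the letter that the second
  player is free to choose.\<close>

definition excess :: "'a \<Rightarrow> 'a \<Rightarrow> nat \<Rightarrow> int" where
  "excess c x i = of_bool (border p i) * (1 + of_bool (p ! i = c)) *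
    (if p ! (m - 1 - i) = x then -1 else 1) * 2 ^ i"

text \<open>The factor 2 encodes odds of 2 : 1 for x p. The powers 2^m from the full overlaps
  cancel, which leaves the borders of p and two small corrections.\<close>

lemma conway_excess:
  assumes "x # p \<noteq> p @ [c]"
  shows "conway (p @ [c]) (p @ [c]) - conway (p @ [c]) (x # p) -
      2 * (conway (x # p) (x # p) - conway (x # p) (p @ [c])) =
    (\<Sum>i<m. excess c x i) - 1 - of_bool (c = x)"
proof -
  have "(\<Sum>i<m. excess c x i) =
      (\<Sum>i<m. of_bool (border p i \<and> p ! i = c) * 2 ^ i
        - of_bool (border p i \<and> p ! i = c \<and> p ! (m - 1 - i) = x) * 2 ^ Suc i
        - 2 * (of_bool (border p i \<and> p ! (m - 1 - i) = x) * 2 ^ i)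
        + of_bool (border p i) * 2 ^ i)"
    by (intro sum.cong refl) (simp add: excess_def)
  also have "\<dots> = (\<Sum>i<m. of_bool (border p i \<and> p ! i = c) * 2 ^ i)
        - (\<Sum>i<m. of_bool (border p i \<and> p ! i = c \<and> p ! (m - 1 - i) = x) * 2 ^ Suc i)
        - 2 * (\<Sum>i<m. of_bool (border p i \<and> p ! (m - 1 - i) = x) * 2 ^ i)
        + (\<Sum>i<m. of_bool (border p i) * 2 ^ i)"
    unfolding sum.distrib sum_subtractf sum_distrib_left ..
  finally have *: "(\<Sum>i<m. excess c x i) = \<dots>" .
  have "X - Y - 2 * (Z - W) = E - 1 - b"
    if "E = s1 - s2 - 2 * s3 + s4" "X = M + s1" "Y = b + s2" "Z = M + s3" "2 * W = M - 1 + s4"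
    for X Y Z W E M b s1 s2 s3 s4 :: int
    using that by simp
  from this[OF * conway_snoc_self conway_snoc_Cons conway_Cons_self conway_Cons_snoc[OF assms]]
  show ?thesis .
qed

lemma border_nth:
  assumes "border p j" "j \<le> m" "i < j"
  shows "p ! (m - j + i) = p ! i"
proof -
  have "p ! (m - j + i) = drop (m - j) p ! i"
    using assms lp by simp
  also have "\<dots> = p ! i"
    using assms lp by (simp add: border_def)
  finally show ?thesis .
qed

lemma borderI_nth:
  assumes "j \<le> m" "\<And>i. i < j \<Longrightarrow> p ! (m - j + i) = p ! i"
  shows "border p j"
  using assms lp by (auto simp: border_def list_eq_iff_nth_eq)

text \<open>The two borders are shifts by m - j - 1 and m - j, which send the letters i + 1 and i to
  the same position m - j + i.\<close>

lemma adjacent_borders_constant: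
  assumes "border p (Suc j)" "border p j" "Suc j \<le> m" "i \<le> j"
  shows "p ! i = p ! 0"
  using \<open>i \<le> j\<close>
proof (induction i)
  case (Suc i)
  have "p ! Suc i = p ! (m - Suc j + Suc i)"
    using border_nth[OF assms(1,3), of "Suc i"] Suc.prems by simp
  also have "m - Suc j + Suc i = m - j + i"
    using assms by simp
  also have "p ! (m - j + i) = p ! i"
    using border_nth[OF assms(2)] assms Suc.prems by simp
  finally show ?case using Suc by simp
qed simp

end

text \<open>
  With \<open>J\<close> the longest border, either the prefix of length \<open>J\<close> is constant, and the sum is explicit,
  or \<open>J - 1\<close> is not a border, and choosing \<open>x\<close> to make the term of \<open>J\<close> positive outweighs the rest.
\<close>

lemma exists_excess_nonneg:
  fixes p :: "bool list"
  assumes lp: "length p = m" and m: "3 \<le> m" and nt: "\<not> (c = p ! 0 \<and> p \<in> tame c m)"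
  shows "\<exists>x. x # p \<noteq> p @ [c] \<and> 0 \<le> (\<Sum>i<m. excess p m c x i) - 1 - of_bool (c = x)"
proof -
  let ?e = "excess p m c"
  define J where "J = Max {j. j < m \<and> border p j}"
  define a where "a = p ! 0"
  have fin: "finite {j. j < m \<and> border p j}" and "0 \<in> {j. j < m \<and> border p j}"
    using m by auto
  hence "J \<in> {j. j < m \<and> border p j}"
    unfolding J_def by (intro Max_in) auto
  hence J: "J < m" "border p J" by auto
  have J_max: "\<not> border p j" if "J < j" "j < m" for j
    using that Max_ge[OF fin, of j] by (auto simp: J_def[symmetric])
  have top: "?e x J = (1 + of_bool (p ! J = c)) * (if p ! (m - 1 - J) = x then -1 else 1) * 2 ^ J" for x
    using J by (simp add: excess_def[OF lp])
  have split: "(\<Sum>i<m. ?e x i) = ?e x J + (\<Sum>i<J. ?e x i)" for x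
  proof -
    have "(\<Sum>i<Suc J. ?e x i) = (\<Sum>i<m. ?e x i)"
      using J J_max by (intro sum.mono_neutral_left) (auto simp: excess_def[OF lp])
    thus ?thesis by simp
  qed
  have pow: "(2::int) ^ J \<ge> 1" by simp
  \<comment> \<open>Comparing letters, x p = p c forces every letter of p, and c, to be x.\<close>
  have distinct: "x # p \<noteq> p @ [c]" if "c \<noteq> x \<or> (\<exists>i<m. p ! i \<noteq> x)" for x
  proof
    assume eq: "x # p = p @ [c]"
    have "p ! i = x" if "i < m" for i
      using that
    proof (induction i)
      case 0
      thus ?case using arg_cong[OF eq, of "\<lambda>w. w ! 0"] lp by (simp add: nth_append)
    next
      case (Suc i)
      thus ?case using arg_cong[OF eq, of "\<lambda>w. w ! Suc i"] lp by (simp add: nth_append)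
    qed
    moreover have "p ! (m - 1) = c"
      using arg_cong[OF eq, of last] m lp by (cases p rule: rev_cases) auto
    ultimately show False using that m by auto
  qed
  have pre: "\<exists>i<m. p ! i \<noteq> x" if "p ! (m - 1 - J) \<noteq> x" for x
    using that m by (intro exI[of _ "m - 1 - J"]) auto
  show ?thesis
  proof (cases "\<forall>i<J. p ! i = a")
    case False
    have "2 \<le> J"
    proof (rule ccontr)
      assume "\<not> 2 \<le> J"
      hence "J = 0 \<or> J = 1" by auto
      thus False using False by (auto simp: a_def)
    qed
    then obtain K where K: "J = Suc K" "1 \<le> K"
      by (cases J) auto
    have gap: "\<not> border p K"
    proof
      assume "border p K"
      hence "p ! i = a" if "i \<le> K" for i
        using adjacent_borders_constant[OF lp, of K i] J K that by (simp add: a_def)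
      thus False using False K(1) by auto
    qed
    \<comment> \<open>This x differs from the letter before the suffix copy of the longest border,
      so the term of J is at least 2^J. Without the border K the other terms sum to at least 2 -
      2^J, and the surplus 2 pays for 1 + \<open>of_bool (c = x)\<close>.\<close>
    define x where "x = (\<not> p ! (m - 1 - J))"
    have x: "p ! (m - 1 - J) \<noteq> x" by (simp add: x_def)
    have "(\<Sum>i<J. ?e x i) = (\<Sum>i<K. ?e x i)"
      using gap by (simp add: K(1) excess_def[OF lp])
    also have "\<dots> \<ge> (\<Sum>i<K. - (2 * 2 ^ i))"
      by (intro sum_mono) (auto simp: excess_def[OF lp])
    also have "(\<Sum>i<K. - (2 * 2 ^ i)) = - (2 * (\<Sum>i<K. (2::int) ^ i))"
      by (simp add: sum_negf sum_distrib_left)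
    also have "\<dots> = 2 - (2::int) ^ J"
      using power_diff_1_eq[of "2::int" K] by (simp add: K(1))
    finally have "(\<Sum>i<J. ?e x i) \<ge> 2 - 2 ^ J" .
    moreover have "?e x J \<ge> 2 ^ J"
      unfolding top using x by auto
    moreover have "of_bool (c = x) \<le> (1 :: int)"
      by simp
    ultimately have "0 \<le> (\<Sum>i<m. ?e x i) - 1 - of_bool (c = x)"
      using split[of x] by linarith
    thus ?thesis
      using distinct[of x] pre[OF x] by blast
  next
    case True
    \<comment> \<open>A constant border of length J makes every smaller length a border, and all
      their terms have the same sign, so the sum is geometric.\<close>
    have lower: "(\<Sum>i<J. ?e x i) = (1 + of_bool (a = c)) * (if a = x then -1 else 1) * (2 ^ J - 1)" for x
    proof -
      have "?e x i = (1 + of_bool (a = c)) * (if a = x then -1 else 1) * 2 ^ i" if i: "i < J" for i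
      proof -
        have last: "p ! (m - i' - 1) = a" if "i' < J" for i'
          using border_nth[OF lp J(2), of "J - 1 - i'"] that J True by simp
        have "border p i"
        proof (rule borderI_nth[OF lp])
          fix l assume "l < i"
          thus "p ! (m - i + l) = p ! l"
            using last[of "i - l - 1"] True i J by (simp add: Suc_diff_Suc)
        qed (use i J in auto)
        thus ?thesis
          using True i last[of i] by (simp add: excess_def[OF lp])
      qed
      hence "(\<Sum>i<J. ?e x i) = (\<Sum>i<J. (1 + of_bool (a = c)) * (if a = x then -1 else 1) * 2 ^ i)"
        by simp
      also have "\<dots> = (1 + of_bool (a = c)) * (if a = x then -1 else 1) * (2 ^ J - 1)"
        using power_diff_1_eq[of "2::int" J] by (simp flip: sum_distrib_left)
      finally show ?thesis .
    qed
    show ?thesis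
    proof (cases "p ! (m - 1 - J) = a")
      case pre_a: True
      \<comment> \<open>With x the letter other than a, all terms are positive. For J = 0 the last
        letter would be a, which makes 1 a border, against maximality.\<close>
      have "J \<noteq> 0"
      proof
        assume "J = 0"
        hence "border p 1"
          using pre_a m by (intro borderI_nth[OF lp]) (auto simp: a_def)
        thus False using J_max[of 1] \<open>J = 0\<close> m by auto
      qed
      hence "(2::int) ^ 1 \<le> 2 ^ J"
        by (intro power_increasing) auto
      thus ?thesis
        using split[of "\<not> a"] distinct[of "\<not> a"] pre[of "\<not> a"] pre_a
        by (intro exI[of _ "\<not> a"]) (auto simp: top lower)
    next
      case pre_na: False
      show ?thesis
      proof (cases "c = a \<and> p ! J \<noteq> a")
        case False
        \<comment> \<open>With x = a, the term of J exceeds the opposing lower sum by at least 1 if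
          c differs from a, and by exactly 2 if c = a = \<open>p ! J\<close>. Either way 1 +
          \<open>of_bool (c = x)\<close> is covered.\<close>
        thus ?thesis
          using split[of a] distinct[of a] pre[of a] pre_na pow
          by (intro exI[of _ a]) (auto simp: top lower)
      next
        case c: True
        have "J \<noteq> 0" using c by (metis a_def)
        moreover have "J \<noteq> 1"
        proof
          assume [simp]: "J = 1"
          have "p ! (m - 1) = a"
            using border_nth[OF lp J(2), of 0] J by (simp add: a_def)
          hence "p \<in> tame c m"
            using c pre_na lp m J_max by (auto simp: tame_def a_def numeral_2_eq_2)
          thus False using nt c by (simp add: a_def)
        qed
        ultimately have "(2::int) ^ 2 \<le> 2 ^ J"
          by (intro power_increasing) auto
        \<comment> \<open>With x the other letter, the top term is -2^J and the lower sum 2 (2^J -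
          1). The total is large enough once J \<ge> 2, while J = 1 is exactly the tame
          case.\<close>
        moreover have "(\<Sum>i<m. ?e (\<not> a) i) = 2 ^ J - 2"
          unfolding split top lower using c pre_na by auto
        ultimately show ?thesis
          using distinct[of "\<not> a"] c by (intro exI[of _ "\<not> a"]) auto
      qed
    qed
  qed
qed

section \<open>The bound 1/3 outside the tame strings\<close>

lemma finite_opponents: "finite (win_prob A ` {B. length B = length A \<and> B \<noteq> A})"
  using finite_lists_length_eq[of "UNIV :: bool set" "length A"]
  by (intro finite_imageI) (auto elim: rev_finite_subset)

lemma guaranteed_le: "B \<noteq> A \<Longrightarrow> length B = length A \<Longrightarrow> guaranteed_win_prob A \<le> win_prob A B"
  unfolding guaranteed_win_prob_def
  by (rule Min_le[OF finite_opponents]) auto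

lemma guaranteed_not_tame_le:
  assumes lp: "length p = m" and m: "3 \<le> m" and nt: "\<not> (c = p ! 0 \<and> p \<in> tame c m)"
  shows "guaranteed_win_prob (p @ [c]) \<le> 1 / 3"
proof -
  let ?A = "p @ [c]"
  obtain x where x: "x # p \<noteq> ?A" and e: "0 \<le> (\<Sum>i<m. excess p m c x i) - 1 - of_bool (c = x)"
    using exists_excess_nonneg[OF assms] by blast
  let ?B = "x # p" and ?P = "win_prob (p @ [c]) (x # p)"
  define \<alpha> where "\<alpha> = real_of_int (conway ?A ?A - conway ?A ?B)"
  define \<beta> where "\<beta> = real_of_int (conway ?B ?B - conway ?B ?A)"
  have "2 * (conway ?B ?B - conway ?B ?A) \<le> conway ?A ?A - conway ?A ?B"
    using conway_excess[OF lp x] e by simp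
  hence "2 * \<beta> \<le> \<alpha>"
    unfolding \<alpha>_def \<beta>_def by (metis of_int_le_iff of_int_mult of_int_numeral)
  moreover have "0 < \<beta>"
    using conway_self_ge[of ?B m] conway_distinct_less[of ?B m ?A] x lp unfolding \<beta>_def by simp
  moreover have "\<alpha> * ?P = \<beta> * (1 - ?P)"
    unfolding \<alpha>_def \<beta>_def using conway_odds[of ?A ?B] x lp by simp
  moreover have "0 \<le> ?P"
    by (simp add: win_prob_def)
  ultimately have "\<beta> * (2 * ?P) \<le> \<beta> * (1 - ?P)"
    using mult_right_mono[of "2 * \<beta>" \<alpha> ?P] by (simp add: mult_ac)
  hence "?P \<le> 1 / 3"
    using \<open>0 < \<beta>\<close> by simp
  thus ?thesis
    using guaranteed_le[of ?B ?A] x by simp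
qed

section \<open>The common value of the tame strings\<close>

context
  fixes p :: "bool list" and m :: nat and a :: bool
  assumes tame: "p \<in> tame a m"
begin

lemma tame_length: "length p = m" and tame_ge: "3 \<le> m"
  using tame by (auto simp: tame_def)

lemma tame_border_iff: "i < m \<Longrightarrow> border p i \<longleftrightarrow> i = 0 \<or> i = 1"
proof -
  assume i: "i < m"
  have "border p 1"
    using tame by (intro borderI_nth[OF tame_length]) (auto simp: tame_def)
  thus ?thesis using tame i by (cases "2 \<le> i") (auto simp: tame_def le_Suc_eq numeral_2_eq_2 not_le less_Suc_eq)
qed

lemma sum_tame_border:
  fixes f :: "nat \<Rightarrow> int"
  shows "(\<Sum>i<m. of_bool (border p i \<and> Q i) * f i) = of_bool (Q 0) * f 0 + of_bool (Q 1) * f 1"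
proof -
  have "(\<Sum>i<m. of_bool (border p i \<and> Q i) * f i) = (\<Sum>i\<in>{0, 1}. of_bool (border p i \<and> Q i) * f i)"
    using tame_ge by (intro sum.mono_neutral_right) (auto simp: tame_border_iff)
  thus ?thesis using tame_border_iff tame_ge by simp
qed

lemma conway_tame_self: "conway (p @ [a]) (p @ [a]) = 2 ^ m + 1"
  using tame unfolding conway_snoc_self[OF tame_length] sum_tame_border by (simp add: tame_def)

lemma conway_Cons_tame: 
  assumes "x # p \<noteq> p @ [a]"
  shows "conway (x # p) (p @ [a]) = 2 ^ (m - 1) + 1"
proof -
  have "2 * conway (x # p) (p @ [a]) = 2 ^ m + 2"
    using conway_Cons_snoc[OF tame_length assms] sum_tame_border[of "\<lambda>i. True" "\<lambda>i. 2 ^ i"] by simp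
  moreover have "(2::int) ^ m = 2 * 2 ^ (m - 1)"
    using tame_ge by (simp flip: power_Suc)
  ultimately show ?thesis by simp
qed

lemma tame_Cons_ne: "x # p \<noteq> p @ [a]"
proof
  assume eq: "x # p = p @ [a]"
  have "p ! 0 = p ! 1"
    using arg_cong[OF eq, of "\<lambda>w. w ! 1"] tame_length tame_ge by (simp add: nth_append)
  moreover have "p ! 0 = a" "p ! 1 \<noteq> a"
    using tame by (auto simp: tame_def)
  ultimately show False by simp
qed

lemma conway_tame_Cons:
  "conway (p @ [a]) (x # p) = (if x = a then 3 else 0)"
  using tame unfolding conway_snoc_Cons[OF tame_length] sum_tame_border by (auto simp: tame_def)

lemma conway_Cons_tame_self:
  "conway (x # p) (x # p) = (if x = a then 2 ^ m + 1 else 2 ^ m + 2)"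
  using tame unfolding conway_Cons_self[OF tame_length] sum_tame_border
  by (auto simp: tame_def numeral_2_eq_2)

text \<open>With N = 2^(m-1) the bound means odds N + 1 : 2 N + 1. For replies x p both differences
  are explicit, and x \<noteq> a gives equality. Any other reply overlaps A in at most m - 1
  letters, so BA \<le> N - 1 and BB - BA \<ge> N + 1, while AA - AB \<le> AA = 2 N + 1.\<close>

lemma win_prob_tame_ge:
  assumes B: "length B = Suc m" "B \<noteq> p @ [a]"
  shows "(2 ^ (m - 1) + 1) / (3 * 2 ^ (m - 1) + 2) \<le> win_prob (p @ [a]) B"
proof -
  let ?A = "p @ [a]" and ?P = "win_prob (p @ [a]) B"
  define N :: int where "N = 2 ^ (m - 1)"
  have N: "2 ^ m = 2 * N" "0 < N"
    using tame_ge by (simp_all add: N_def flip: power_Suc)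
  define \<alpha> where "\<alpha> = conway ?A ?A - conway ?A B"
  define \<beta> where "\<beta> = conway B B - conway B ?A"
  have key: "0 < \<beta> \<and> 0 \<le> \<alpha> \<and> \<alpha> * (N + 1) \<le> \<beta> * (2 * N + 1)"
  proof (cases "tl B = p")
    case True
    then obtain x where B': "B = x # p"
      using B by (cases B) auto
    show ?thesis
    proof (cases "x = a")
      case True
      have "\<alpha> = 2 * N - 2" "\<beta> = N"
        unfolding \<alpha>_def \<beta>_def B'
        using conway_tame_self conway_Cons_tame[OF tame_Cons_ne] conway_tame_Cons[of x] conway_Cons_tame_self[of x] True N
        by (simp_all add: N_def)
      moreover have "(2 * N - 2) * (N + 1) \<le> N * (2 * N + 1)"
        using N by (simp add: algebra_simps)
      ultimately show ?thesis using N by simp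
    next
      case False
      have "\<alpha> = 2 * N + 1" "\<beta> = N + 1"
        unfolding \<alpha>_def \<beta>_def B'
        using conway_tame_self conway_Cons_tame[OF tame_Cons_ne] conway_tame_Cons[of x] conway_Cons_tame_self[of x] False N
        by (simp_all add: N_def)
      thus ?thesis using N by (simp add: algebra_simps)
    qed
  next
    case False
    define k where "k = m - 1"
    have k: "m = Suc k" using tame_ge by (simp add: k_def)
    let ?f = "\<lambda>i. of_bool (drop (m - i) B = take (Suc i) ?A) * 2 ^ i :: int"
    have "conway B ?A = (\<Sum>i<Suc (Suc k). ?f i)"
      unfolding conway_Suc[OF B(1)] k by (simp add: lessThan_Suc_atMost)
    also have "?f m = 0"
      using B tame_length by simp
    hence "(\<Sum>i<Suc (Suc k). ?f i) = (\<Sum>i<Suc k. ?f i)"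
      unfolding k[symmetric] by simp
    also have "?f k = 0"
      using False tame_length k by (simp add: drop_Suc)
    hence "(\<Sum>i<Suc k. ?f i) = (\<Sum>i<k. ?f i)"
      by simp
    also have "\<dots> \<le> 2 ^ k - 1"
      by (rule sum_of_bool_power_le)
    finally have "conway B ?A \<le> N - 1"
      by (simp add: N_def k_def)
    hence \<beta>: "N + 1 \<le> \<beta>"
      using conway_self_ge[OF B(1)] N by (simp add: \<beta>_def)
    have \<alpha>: "\<alpha> \<le> 2 * N + 1"
      using conway_tame_self conway_nonneg[of ?A B] N by (simp add: \<alpha>_def)
    have "0 \<le> \<alpha>"
      using conway_self_ge[of ?A m] conway_distinct_less[of ?A m B] B tame_length by (simp add: \<alpha>_def)
    moreover have "\<alpha> * (N + 1) \<le> (2 * N + 1) * \<beta>"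
      using \<alpha> \<beta> N by (intro mult_mono) auto
    ultimately show ?thesis using \<beta> N by (simp add: mult.commute)
  qed
  have "real_of_int \<alpha> * ?P = real_of_int \<beta> * (1 - ?P)"
    unfolding \<alpha>_def \<beta>_def using conway_odds[of ?A B] B tame_length by simp
  hence P: "?P = real_of_int \<beta> / real_of_int (\<alpha> + \<beta>)"
    using key by (simp add: field_simps)
  have "\<alpha> * (N + 1) \<le> \<beta> * (2 * N + 1)"
    using key by blast
  hence "(N + 1) * (\<alpha> + \<beta>) \<le> \<beta> * (3 * N + 2)"
    by (simp add: algebra_simps)
  hence "real_of_int ((N + 1) * (\<alpha> + \<beta>)) \<le> real_of_int (\<beta> * (3 * N + 2))"
    by (simp only: of_int_le_iff)
  hence "real_of_int (N + 1) / real_of_int (3 * N + 2) \<le> ?P"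
    unfolding P using key N by (simp add: field_simps)
  thus ?thesis by (simp add: N_def)
qed

text \<open>The reply x p with x the other letter attains the lower bound. The value depends on m
  alone, so all tame strings tie.\<close>

lemma guaranteed_tame:
  "guaranteed_win_prob (p @ [a]) = (2 ^ (m - 1) + 1) / (3 * 2 ^ (m - 1) + 2)"
proof (rule antisym)
  let ?A = "p @ [a]" and ?B = "(\<not> a) # p" and ?P = "win_prob (p @ [a]) ((\<not> a) # p)"
  have N: "(2::int) ^ m = 2 * 2 ^ (m - 1)"
    using tame_ge by (simp flip: power_Suc)
  have "real_of_int (2 * 2 ^ (m - 1) + 1) * ?P = real_of_int (2 ^ (m - 1) + 1) * (1 - ?P)"
    using conway_odds[of ?A ?B] tame_Cons_ne[of "\<not> a"] conway_tame_self conway_tame_Cons[of "\<not> a"]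
      conway_Cons_tame_self[of "\<not> a"] conway_Cons_tame[of "\<not> a"] N by simp
  hence "(3 * 2 ^ (m - 1) + 2) * ?P = 2 ^ (m - 1) + 1"
    by (simp add: algebra_simps)
  moreover have "3 * 2 ^ (m - 1) + (2 :: real) > 0"
    by (simp add: add_pos_pos)
  ultimately have "?P = (2 ^ (m - 1) + 1) / (3 * 2 ^ (m - 1) + 2)"
    by (simp add: nonzero_eq_divide_eq mult.commute)
  thus "guaranteed_win_prob ?A \<le> (2 ^ (m - 1) + 1) / (3 * 2 ^ (m - 1) + 2)"
    using guaranteed_le[of ?B ?A] tame_Cons_ne by simp
  have "?B \<in> {B. length B = length ?A \<and> B \<noteq> ?A}"
    using tame_Cons_ne by simp
  hence "{B. length B = length ?A \<and> B \<noteq> ?A} \<noteq> {}"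
    by blast
  thus "(2 ^ (m - 1) + 1) / (3 * 2 ^ (m - 1) + 2) \<le> guaranteed_win_prob ?A"
    unfolding guaranteed_win_prob_def using win_prob_tame_ge tame_length
    by (intro Min.boundedI finite_opponents) auto
qed

end

text \<open>In a b ... b a with only b inside, a border of length j \<ge> 2 other than the whole
  word would put an a at the inner position m - j.\<close>

lemma tame_nonempty:
  assumes "3 \<le> m"
  shows "tame (a :: bool) m \<noteq> {}"
proof -
  define p where "p = a # replicate (m - 2) (\<not> a) @ [a]"
  have lp: "length p = m" using assms by (simp add: p_def)
  have nth: "p ! i = (if i = 0 \<or> i = m - 1 then a else \<not> a)" if "i < m" for i
    using that assms by (cases i) (auto simp: p_def nth_append)
  have "\<not> border p j" if "2 \<le> j" "j < m" for j
  proof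
    assume "border p j"
    hence "p ! (m - j) = p ! 0"
      using border_nth[OF lp, of j 0] that by simp
    moreover have "m - j \<noteq> m - 1" "m - j \<noteq> 0" "m - j < m"
      using that by auto
    ultimately show False using nth[of 0] nth[of "m - j"] assms by simp
  qed
  hence "p \<in> tame a m"
    using assms lp nth by (auto simp: tame_def)
  thus ?thesis by blast
qed

text \<open>Tame strings exist and share a value above 1/3, and every other string is held to at
  most 1/3.\<close>

lemma optimal_strategy_iff:
  assumes n: "4 \<le> n"
  shows "optimal_strategy n A \<longleftrightarrow> (\<exists>a. \<exists>p \<in> tame a (n - 1). A = p @ [a])"
proof -
  define m where "m = n - 1"
  have m: "3 \<le> m" "n = Suc m" using n by (auto simp: m_def)
  define v :: real where "v = (2 ^ (m - 1) + 1) / (3 * 2 ^ (m - 1) + 2)"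
  have v: "1 / 3 < v" by (simp add: v_def field_simps add_pos_pos)
  have good: "guaranteed_win_prob (p @ [a]) = v" if "p \<in> tame a m" for p and a :: bool
    using guaranteed_tame[OF that] by (simp add: v_def)
  have bad: "guaranteed_win_prob A \<le> 1 / 3"
    if "length A = n" "\<not> (\<exists>a. \<exists>p \<in> tame a m. A = p @ [a])" for A
    using that m guaranteed_not_tame_le[of "butlast A" m "last A"]
    by (cases A rule: rev_cases) auto
  have len: "length (p @ [a]) = n" if "p \<in> tame a m" for p and a :: bool
    using that m by (auto simp: tame_def)
  obtain q where q: "q \<in> tame True m"
    using tame_nonempty[OF m(1)] by blast
  have le: "guaranteed_win_prob A \<le> v" if "length A = n" for A
    using bad[OF that] good v by fastforce
  show ?thesis
    unfolding optimal_strategy_def is_arg_max_def m_def[symmetric]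
  proof
    assume A: "length A = n \<and> (\<nexists>y. length y = n \<and> guaranteed_win_prob A < guaranteed_win_prob y)"
    hence "\<not> guaranteed_win_prob A < v"
      using good[OF q] len[OF q] by metis
    thus "\<exists>a. \<exists>p \<in> tame a m. A = p @ [a]"
      using bad[of A] A v by fastforce
  next
    assume "\<exists>a. \<exists>p \<in> tame a m. A = p @ [a]"
    thus "length A = n \<and> (\<nexists>y. length y = n \<and> guaranteed_win_prob A < guaranteed_win_prob y)"
      using good len le by (metis not_le)
  qed
qed

section \<open>Counting the optimal strings\<close>

definition framed :: "bool \<Rightarrow> nat \<Rightarrow> bool list set" where
  "framed a m = {p. length p = m \<and> 3 \<le> m \<and> p ! 0 = a \<and> p ! 1 \<noteq> a \<and> p ! (m - 2) \<noteq> a \<and> p ! (m - 1) = a}"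

text \<open>Tameness of the prefix says that no length from 2 to k - 1 is a border of p, by
  \<open>border_take_iff\<close>.\<close>

definition shortest_border :: "bool \<Rightarrow> nat \<Rightarrow> nat \<Rightarrow> bool list set" where
  "shortest_border a m k = {p \<in> framed a m. take k p \<in> tame a k \<and> border p k}"

lemma tame_subset_framed: "tame a m \<subseteq> framed a m"
  by (auto simp: tame_def framed_def)

lemma finite_framed [simp]: "finite (framed a m)"
  by (rule finite_subset[OF _ finite_lists_length_eq[of UNIV m]]) (auto simp: framed_def)

lemma finite_tame [simp]: "finite (tame a m :: bool list set)"
  using finite_subset[OF tame_subset_framed finite_framed] .

lemma finite_shortest_border [simp]: "finite (shortest_border a m k)"
  by (simp add: shortest_border_def)

text \<open>The prefix and the suffix of length k are the same word, so the short suffix of p is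
  also a suffix of that prefix.\<close>

lemma border_take_iff:
  assumes "border p k" "j \<le> k" "k \<le> length p"
  shows "border (take k p) j \<longleftrightarrow> border p j"
proof -
  have "drop (k - j) (take k p) = drop (k - j) (drop (length p - k) p)"
    using assms by (simp add: border_def)
  also have "\<dots> = drop (length p - j) p"
    using assms by simp
  finally show ?thesis
    using assms by (simp add: border_def min_absorb1)
qed

text \<open>For m \<ge> 4 the four prescribed positions are distinct, and the m - 4 letters between
  them are free.\<close>

lemma card_framed:
  assumes m: "4 \<le> m"
  shows "card (framed a m) = 2 ^ (m - 4)"
proof -
  let ?f = "\<lambda>w. a # (\<not> a) # w @ [\<not> a, a]"
  have "framed a m = ?f ` {w. set w \<subseteq> UNIV \<and> length w = m - 4}"
  proof (intro equalityI subsetI)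
    fix p assume p: "p \<in> framed a m"
    hence lp: "length p = m" by (simp add: framed_def)
    define w where "w = take (m - 4) (drop 2 p)"
    have w: "length w = m - 4" using lp by (simp add: w_def)
    have "p = ?f w"
    proof (rule nth_equalityI)
      fix i assume "i < length p"
      then consider "i = 0" | "i = 1" | l where "i = Suc (Suc l)" "l < m - 4" | "i = m - 2" | "i = m - 1"
        using lp by (cases i; cases "i - 1") (auto, linarith)
      thus "p ! i = ?f w ! i"
        using p m lp w by cases (auto simp: framed_def w_def nth_append nth_Cons' numeral_2_eq_2)
    qed (use lp m w in simp)
    thus "p \<in> ?f ` {w. set w \<subseteq> UNIV \<and> length w = m - 4}"
      using w by blast
  next
    fix p assume "p \<in> ?f ` {w. set w \<subseteq> UNIV \<and> length w = m - 4}"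
    then obtain w where w: "p = ?f w" "length w = m - 4" by blast
    have "p ! (m - 1) = a" "p ! (m - 2) = (\<not> a)" "p ! 0 = a" "p ! 1 = (\<not> a)"
      using w m by (auto simp: nth_append nth_Cons' numeral_2_eq_2)
    thus "p \<in> framed a m"
      using w m by (auto simp: framed_def)
  qed
  moreover have "inj_on ?f {w. set w \<subseteq> UNIV \<and> length w = m - 4}"
    by (auto simp: inj_on_def)
  ultimately show ?thesis
    using card_lists_length_eq[of "UNIV :: bool set" "m - 4"] by (simp add: card_image)
qed

text \<open>Take the shortest border of length k \<ge> 2. Since it starts with a b and ends with b
  a, k \<ge> 3. Its two copies share at most one letter, since a common part of 2 k - m \<ge> 2
  letters would be a shorter border.\<close>

lemma framed_partition:
  "framed a m = tame a m \<union> (\<Union>k\<in>{k. 3 \<le> k \<and> 2 * k \<le> Suc m \<and> k < m}. shortest_border a m k)"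
proof (intro equalityI subsetI)
  fix p assume p: "p \<in> framed a m"
  show "p \<in> tame a m \<union> (\<Union>k\<in>{k. 3 \<le> k \<and> 2 * k \<le> Suc m \<and> k < m}. shortest_border a m k)"
  proof (cases "p \<in> tame a m")
    case False
    have lp: "length p = m" and m: "3 \<le> m"
      and letters: "p ! 0 = a" "p ! 1 = (\<not> a)" "p ! (m - 2) = (\<not> a)" "p ! (m - 1) = a"
      using p by (auto simp: framed_def)
    have ex: "\<exists>j. 2 \<le> j \<and> j < m \<and> border p j"
      using False p by (auto simp: tame_def framed_def)
    define k where "k = (LEAST j. 2 \<le> j \<and> j < m \<and> border p j)"
    have k: "2 \<le> k" "k < m" "border p k"
      using LeastI_ex[OF ex] by (auto simp: k_def)
    have least: "\<not> border p j" if "2 \<le> j" "j < k" for j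
      using not_less_Least[of j "\<lambda>j. 2 \<le> j \<and> j < m \<and> border p j"] that k by (auto simp: k_def[symmetric])
    have nth: "p ! (m - k + i) = p ! i" if "i < k" for i
      using border_nth[OF lp k(3)] k that by simp
    have last1: "p ! (k - 1) = a"
      using nth[of "k - 1"] k letters by simp
    have last2: "p ! (k - 2) = (\<not> a)"
      using nth[of "k - 2"] k letters by (simp add: numeral_2_eq_2)
    have k3: "3 \<le> k"
      using last1 last2 letters k(1) by (cases "k = 2") auto
    have "\<not> border (take k p) j" if "2 \<le> j" "j < k" for j
      using least[OF that] border_take_iff[OF k(3), of j] that k lp by simp
    hence tame: "take k p \<in> tame a k"
      using k k3 lp letters last1 last2 by (auto simp: tame_def)
    have "2 * k \<le> Suc m"
    proof (rule ccontr)
      assume long: "\<not> 2 * k \<le> Suc m"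
      have "border p (2 * k - m)"
      proof (rule borderI_nth[OF lp])
        fix i assume i: "i < 2 * k - m"
        have "p ! (m - (2 * k - m) + i) = p ! (m - k + (m - k + i))"
          using long k by (intro arg_cong[where f = "(!) p"]) auto
        also have "\<dots> = p ! i"
          using nth[of "m - k + i"] nth[of i] i k by simp
        finally show "p ! (m - (2 * k - m) + i) = p ! i" .
      qed (use k in auto)
      thus False using least[of "2 * k - m"] long k by auto
    qed
    hence "k \<in> {k. 3 \<le> k \<and> 2 * k \<le> Suc m \<and> k < m}" "p \<in> shortest_border a m k"
      using k k3 tame p by (auto simp: shortest_border_def)
    thus ?thesis by blast
  qed simp
qed (use tame_subset_framed in \<open>auto simp: shortest_border_def\<close>)

lemma tame_Int_shortest_border:
  assumes "3 \<le> k" "k < m"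
  shows "tame a m \<inter> shortest_border a m k = {}"
  using assms by (auto simp: tame_def shortest_border_def)

lemma shortest_border_disjoint:
  assumes "3 \<le> k" "k < l" "l < m"
  shows "shortest_border a m k \<inter> shortest_border a m l = {}"
proof (intro equals0I, elim IntE)
  fix p assume "p \<in> shortest_border a m k" "p \<in> shortest_border a m l"
  hence "border (take l p) k" "\<not> border (take l p) k"
    using border_take_iff[of p l k] assms by (auto simp: shortest_border_def tame_def framed_def)
  thus False by blast
qed

text \<open>The two copies of the border are disjoint, so p = u w u with u tame and w
  arbitrary.\<close>

lemma card_shortest_border:
  assumes k: "3 \<le> k" "2 * k \<le> m"
  shows "card (shortest_border a m k) = card (tame a k) * 2 ^ (m - 2 * k)"
proof -
  let ?f = "\<lambda>(u, w). u @ w @ u" and ?D = "tame a k \<times> {w. set w \<subseteq> (UNIV :: bool set) \<and> length w = m - 2 * k}"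
  have "shortest_border a m k = ?f ` ?D"
  proof (intro equalityI subsetI)
    fix p assume p: "p \<in> shortest_border a m k"
    hence lp: "length p = m" by (simp add: shortest_border_def framed_def)
    have "p = take k p @ take (m - 2 * k) (drop k p) @ drop (m - 2 * k) (drop k p)"
      by (metis append_take_drop_id)
    also have "drop (m - 2 * k) (drop k p) = drop (m - k) p"
      using k by (simp only: drop_drop) (rule arg_cong[where f = "\<lambda>j. drop j p"], simp)
    also have "\<dots> = take k p"
      using p lp by (simp add: shortest_border_def border_def)
    finally have "p = ?f (take k p, take (m - 2 * k) (drop k p))" by simp
    moreover have "(take k p, take (m - 2 * k) (drop k p)) \<in> ?D"
      using p lp k by (auto simp: shortest_border_def)
    ultimately show "p \<in> ?f ` ?D" by blast
  next
    fix p assume "p \<in> ?f ` ?D"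
    then obtain u w where uw: "p = u @ w @ u" "u \<in> tame a k" "length w = m - 2 * k" by auto
    have lu: "length u = k" and u: "u ! 0 = a" "u ! 1 \<noteq> a" "u ! (k - 2) \<noteq> a" "u ! (k - 1) = a"
      using uw by (auto simp: tame_def)
    have "p ! (m - k + i) = u ! i" if "i < k" for i
      using that uw(1,3) lu k by (auto simp: nth_append)
    from this[of "k - 1"] this[of "k - 2"] have "p ! (m - 1) = u ! (k - 1)" "p ! (m - 2) = u ! (k - 2)"
      using k by auto
    hence "p \<in> framed a m"
      using u uw lu k by (auto simp: framed_def nth_append)
    moreover have "border p k"
      using uw lu k by (simp add: border_def)
    ultimately show "p \<in> shortest_border a m k"
      using uw lu by (simp add: shortest_border_def)
  qed
  moreover have "inj_on ?f ?D"
    by (auto simp: inj_on_def tame_def)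
  moreover have "card ?D = card (tame a k) * 2 ^ (m - 2 * k)"
    using card_lists_length_eq[of "UNIV :: bool set" "m - 2 * k"] by (simp add: card_cartesian_product)
  ultimately show ?thesis
    by (simp add: card_image)
qed

text \<open>The copies share one letter, which is consistent because u begins and ends with a; the
  word is determined by u.\<close>

lemma card_shortest_border_overlap:
  assumes k: "3 \<le> k" "2 * k = Suc m"
  shows "card (shortest_border a m k) = card (tame a k)"
proof -
  let ?f = "\<lambda>u :: bool list. u @ tl u"
  have "shortest_border a m k = ?f ` tame a k"
  proof (intro equalityI subsetI)
    fix p assume p: "p \<in> shortest_border a m k"
    hence lp: "length p = m" by (simp add: shortest_border_def framed_def)
    have "drop k p = tl (drop (m - k) p)"
    proof -
      have "k = Suc (m - k)" using k by simp
      thus ?thesis by (metis drop_Suc tl_drop)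
    qed
    also have "\<dots> = tl (take k p)"
      using p lp by (simp add: shortest_border_def border_def)
    finally have "p = ?f (take k p)"
      by (metis append_take_drop_id)
    thus "p \<in> ?f ` tame a k"
      using p by (auto simp: shortest_border_def)
  next
    fix p assume "p \<in> ?f ` tame a k"
    then obtain u where uw: "p = u @ tl u" "u \<in> tame a k" by auto
    have lu: "length u = k" and u: "u ! 0 = a" "u ! 1 \<noteq> a" "u ! (k - 2) \<noteq> a" "u ! (k - 1) = a"
      using uw by (auto simp: tame_def)
    have nth: "p ! (m - k + i) = u ! i" if "i < k" for i
    proof (cases i)
      case 0
      have "m - k = k - 1" using k by simp
      thus ?thesis using 0 u uw lu k by (simp add: nth_append)
    next
      case (Suc l)
      have *: "m - k + i = k + l" using k Suc by simp
      show ?thesis unfolding * using Suc uw lu that by (simp add: nth_append nth_tl)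
    qed
    have lp: "length p = m" using uw lu k by simp
    from nth[of "k - 1"] nth[of "k - 2"] have "p ! (m - 1) = u ! (k - 1)" "p ! (m - 2) = u ! (k - 2)"
      using k by auto
    hence "p \<in> framed a m"
      using u uw lu k lp by (auto simp: framed_def nth_append)
    moreover have "border p k"
      using nth uw lu k by (intro borderI_nth[OF lp]) (auto simp: nth_append)
    ultimately show "p \<in> shortest_border a m k"
      using uw lu by (simp add: shortest_border_def)
  qed
  moreover have "inj_on ?f (tame a k)"
    by (auto simp: inj_on_def tame_def)
  ultimately show ?thesis
    by (simp add: card_image)
qed

lemma card_tame_rec:
  fixes a :: bool
  assumes m: "4 \<le> m"
  shows "2 ^ (m - 4) = card (tame a m) + (\<Sum>k = 3..m div 2. card (tame a k) * 2 ^ (m - 2 * k)) +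
    (if odd m then card (tame a (Suc m div 2)) else 0)"
proof -
  let ?I = "{k. 3 \<le> k \<and> 2 * k \<le> Suc m \<and> k < m}" and ?s = "\<lambda>k. card (shortest_border a m k)"
  have fin: "finite ?I" by simp
  have "2 ^ (m - 4) = card (tame a m \<union> (\<Union>k\<in>?I. shortest_border a m k))"
    using card_framed[OF m] framed_partition by metis
  also have "\<dots> = card (tame a m) + card (\<Union>k\<in>?I. shortest_border a m k)"
  proof (rule card_Un_disjoint)
    show "tame a m \<inter> (\<Union>k\<in>?I. shortest_border a m k) = {}"
    proof (rule equals0I)
      fix p assume "p \<in> tame a m \<inter> (\<Union>k\<in>?I. shortest_border a m k)"
      then obtain k where "k \<in> ?I" "p \<in> tame a m \<inter> shortest_border a m k" by blast
      thus False using tame_Int_shortest_border[of k m a] by simp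
    qed
  qed (simp_all add: fin)
  also have "card (\<Union>k\<in>?I. shortest_border a m k) = (\<Sum>k\<in>?I. ?s k)"
  proof (rule card_UN_disjoint[OF fin])
    show "\<forall>i\<in>?I. \<forall>j\<in>?I. i \<noteq> j \<longrightarrow> shortest_border a m i \<inter> shortest_border a m j = {}"
    proof (intro ballI impI)
      fix i j assume "i \<in> ?I" "j \<in> ?I" "i \<noteq> j"
      thus "shortest_border a m i \<inter> shortest_border a m j = {}"
        using shortest_border_disjoint[of i j m a] shortest_border_disjoint[of j i m a]
        by (cases i j rule: linorder_cases) (simp_all add: Int_commute)
    qed
  qed simp
  also have "(\<Sum>k\<in>?I. ?s k) = (\<Sum>k = 3..m div 2. ?s k) + (if odd m then ?s (Suc m div 2) else 0)"
  proof (cases "odd m")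
    case True
    then obtain l where l: "m = 2 * l + 1" by (elim oddE)
    have "?I = insert (Suc l) {3..l}" using m l by auto
    thus ?thesis using True l by simp
  next
    case False
    then obtain l where l: "m = 2 * l" by auto
    have "?I = {3..l}" using m l by auto
    thus ?thesis using False l by simp
  qed
  also have "(\<Sum>k = 3..m div 2. ?s k) = (\<Sum>k = 3..m div 2. card (tame a k) * 2 ^ (m - 2 * k))"
    by (intro sum.cong refl card_shortest_border) auto
  also have "(if odd m then ?s (Suc m div 2) else 0) = (if odd m then card (tame a (Suc m div 2)) else 0)"
    using m by (auto intro: card_shortest_border_overlap)
  finally show ?thesis by simp
qed

lemma tame_eq_empty: "m < 3 \<Longrightarrow> tame a m = {}"
  by (auto simp: tame_def)

lemma card_tame_3: "card (tame a 3 :: bool list set) = 1"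
proof -
  have "tame a 3 = {[a, \<not> a, a]}"
  proof (intro equalityI subsetI)
    fix p assume "p \<in> tame a 3"
    thus "p \<in> {[a, \<not> a, a]}"
      by (auto simp: tame_def list_eq_iff_nth_eq less_Suc_eq numeral_3_eq_3)
  next
    fix p assume "p \<in> {[a, \<not> a, a]}"
    moreover have "j = 2" if "2 \<le> j" "j < 3" for j :: nat
      using that by simp
    ultimately show "p \<in> tame a 3"
      by (auto simp: tame_def border_def numeral_2_eq_2 numeral_3_eq_3 less_Suc_eq le_Suc_eq)
  qed
  thus ?thesis by simp
qed

lemma card_tame_le: "card (tame (a :: bool) m) \<le> 2 ^ m"
proof -
  have "card (tame a m) \<le> card {w. set w \<subseteq> (UNIV :: bool set) \<and> length w = m}"
    using finite_lists_length_eq[of "UNIV :: bool set" m] by (intro card_mono) (auto simp: tame_def)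
  thus ?thesis using card_lists_length_eq[of "UNIV :: bool set" m] by simp
qed

text \<open>The recurrence and its initial values do not mention the letter, so strong induction
  replaces an explicit exchange of letters.\<close>

lemma card_tame_eq: "card (tame a m) = card (tame b m)" for a b :: bool
proof (induction m rule: less_induct)
  case (less m)
  show ?case
  proof (cases "4 \<le> m")
    case True
    have "(\<Sum>k = 3..m div 2. card (tame a k) * 2 ^ (m - 2 * k)) =
        (\<Sum>k = 3..m div 2. card (tame b k) * 2 ^ (m - 2 * k))"
      using True by (intro sum.cong refl arg_cong2[where f = "(*)"] less.IH) auto
    moreover have "odd m \<Longrightarrow> card (tame a (Suc m div 2)) = card (tame b (Suc m div 2))"
      using True by (intro less.IH) auto
    ultimately show ?thesis
      using card_tame_rec[OF True, of a] card_tame_rec[OF True, of b] by (auto split: if_splits)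
  next
    case False
    hence "m < 3 \<or> m = 3" by auto
    thus ?thesis by (auto simp: tame_eq_empty card_tame_3)
  qed
qed

lemma num_optimal_eq:
  assumes "4 \<le> n"
  shows "num_optimal n = 2 * card (tame True (n - 1))"
proof -
  let ?O = "\<lambda>a. (\<lambda>p. p @ [a]) ` tame a (n - 1)"
  have "{A. optimal_strategy n A} = ?O True \<union> ?O False"
    using optimal_strategy_iff[OF assms] by (auto simp: image_iff) (metis (full_types))+
  moreover have "card (?O True \<union> ?O False) = card (?O True) + card (?O False)"
    by (rule card_Un_disjoint) auto
  moreover have "card (?O a) = card (tame a (n - 1))" for a :: bool
    by (rule card_image) (auto simp: inj_on_def)
  ultimately show ?thesis
    using card_tame_eq[of False _ True] by (simp add: num_optimal_def)
qed

section \<open>Asymptotics\<close>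

definition num_tame :: "nat \<Rightarrow> real" where
  "num_tame m = real (card (tame True m))"

text \<open>The limit of \<open>num_tame m / 2 ^ m\<close>: framed words have share 1/16, and those
  with shortest border of length k have share \<open>num_tame k / 4 ^ k\<close>, as 2 k letters are
  fixed by the border.\<close>

definition tame_density :: real where
  "tame_density = 1 / 16 - (\<Sum>k. num_tame k / 4 ^ k)"

definition tame_tail :: "nat \<Rightarrow> real" where
  "tame_tail l = (\<Sum>k. num_tame (k + Suc l) / 4 ^ (k + Suc l))"

lemma num_tame_nonneg: "0 \<le> num_tame m"
  by (simp add: num_tame_def)

lemma num_tame_le: "num_tame m \<le> 2 ^ m"
  using card_tame_le[of True m] unfolding num_tame_def by (metis of_nat_le_iff of_nat_numeral of_nat_power)

lemma num_tame_less_3: "m < 3 \<Longrightarrow> num_tame m = 0"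
  by (simp add: num_tame_def tame_eq_empty)

lemma num_tame_rec:
  assumes m: "4 \<le> m"
  shows "num_tame m = 2 ^ m * (1 / 16 - (\<Sum>k\<le>m div 2. num_tame k / 4 ^ k)) -
    (if odd m then num_tame (Suc m div 2) else 0)"
proof -
  have "(2::real) ^ (m - 4) = real (2 ^ (m - 4))"
    by simp
  also have "\<dots> = num_tame m + (\<Sum>k = 3..m div 2. num_tame k * 2 ^ (m - 2 * k)) +
      (if odd m then num_tame (Suc m div 2) else 0)"
    unfolding card_tame_rec[OF m, of True] by (simp add: num_tame_def)
  also have "(\<Sum>k = 3..m div 2. num_tame k * 2 ^ (m - 2 * k)) =
      (\<Sum>k = 3..m div 2. 2 ^ m * (num_tame k / 4 ^ k))"
  proof (intro sum.cong refl)
    fix k assume "k \<in> {3..m div 2}"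
    hence "m = (m - 2 * k) + 2 * k" by auto
    hence "(2::real) ^ m = 2 ^ (m - 2 * k) * 4 ^ k"
      using power_add[of "2::real" "m - 2 * k" "2 * k"] by (simp add: power_mult)
    thus "num_tame k * 2 ^ (m - 2 * k) = 2 ^ m * (num_tame k / 4 ^ k)"
      by simp
  qed
  also have "\<dots> = (\<Sum>k\<le>m div 2. 2 ^ m * (num_tame k / 4 ^ k))"
    by (intro sum.mono_neutral_left) (auto simp: num_tame_less_3)
  also have "(2::real) ^ (m - 4) = 2 ^ m / 16"
    using m power_diff[of "2::real" 4 m] by simp
  finally show ?thesis
    by (simp add: sum_distrib_left right_diff_distrib)
qed

lemma num_tame_even:
  assumes "2 \<le> l"
  shows "num_tame (2 * l) = 4 ^ l * (1 / 16 - (\<Sum>k\<le>l. num_tame k / 4 ^ k))"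
  using num_tame_rec[of "2 * l"] assms by (simp add: power_mult)

lemma num_tame_odd:
  assumes "2 \<le> l"
  shows "num_tame (2 * l + 1) = 2 * num_tame (2 * l) - num_tame (l + 1)"
  using num_tame_rec[of "2 * l + 1"] assms unfolding num_tame_even[OF assms] by (simp add: power_mult)

text \<open>Passing from l to l + 1 multiplies by 4 and subtracts one new summand. With
  \<open>num_tame_odd\<close> this yields values without the growing sum.\<close>

lemma num_tame_even_rec:
  assumes "2 \<le> l"
  shows "num_tame (2 * l + 2) = 2 * num_tame (2 * l + 1) + num_tame (l + 1)"
proof -
  let ?P = "\<Sum>k\<le>l. num_tame k / 4 ^ k"
  have "num_tame (2 * Suc l) = 4 ^ Suc l * (1 / 16 - (\<Sum>k\<le>Suc l. num_tame k / 4 ^ k))"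
    using assms by (intro num_tame_even) simp
  also have "\<dots> = 4 ^ Suc l * (1 / 16 - ?P) - 4 ^ Suc l * (num_tame (Suc l) / 4 ^ Suc l)"
    unfolding sum.atMost_Suc by (simp only: right_diff_distrib distrib_left diff_diff_eq)
  also have "\<dots> = 4 * num_tame (2 * l) - num_tame (l + 1)"
    unfolding num_tame_even[OF assms] by simp
  finally show ?thesis
    unfolding num_tame_odd[OF assms] by simp
qed

lemma summable_num_tame: "summable (\<lambda>k. num_tame k / 4 ^ k)"
proof (rule summable_comparison_test')
  show "summable (\<lambda>k. (1 / 2 :: real) ^ k)" by (rule summable_geometric) simp
  fix k :: nat
  have "num_tame k / 4 ^ k \<le> 2 ^ k / 4 ^ k"
    by (intro divide_right_mono num_tame_le) simp
  also have "\<dots> = (1 / 2) ^ k"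
    by (simp flip: power_divide)
  finally show "norm (num_tame k / 4 ^ k) \<le> (1 / 2) ^ k"
    by (simp add: num_tame_nonneg)
qed

lemma summable_tame_tail: "summable (\<lambda>k. num_tame (k + Suc l) / 4 ^ (k + Suc l))"
  by (rule summable_ignore_initial_segment[OF summable_num_tame])

text \<open>This rewrites the bracket of \<open>num_tame_rec\<close>, so that the deviation from the
  density is carried by the tail.\<close>

lemma tame_density_split: "1 / 16 - (\<Sum>k\<le>l. num_tame k / 4 ^ k) = tame_density + tame_tail l"
  using suminf_split_initial_segment[OF summable_num_tame, of "Suc l"]
  by (simp add: tame_density_def tame_tail_def lessThan_Suc_atMost)

lemma tame_tail_nonneg: "0 \<le> tame_tail l"
  unfolding tame_tail_def by (intro suminf_nonneg summable_tame_tail) (simp add: num_tame_nonneg)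

lemma geometric_tail_sums:
  fixes r :: real
  assumes "\<bar>r\<bar> < 1"
  shows "(\<lambda>k. r ^ (k + j)) sums (r ^ j / (1 - r))"
  using sums_mult[OF geometric_sums[of r], of "r ^ j"] assms by (simp add: power_add mult.commute)

text \<open>Comparison with a geometric series. The constant is 1/16 for the numerical bounds and 1
  for the error estimate.\<close>

lemma tame_tail_le:
  assumes "\<And>k. l < k \<Longrightarrow> num_tame k \<le> C * 2 ^ k"
  shows "tame_tail l \<le> C / 2 ^ l"
proof -
  have sums: "(\<lambda>k. C * (1 / 2) ^ (k + Suc l)) sums (C * ((1 / 2) ^ Suc l / (1 - 1 / 2)))"
    by (intro sums_mult geometric_tail_sums) simp
  have "tame_tail l \<le> (\<Sum>k. C * (1 / 2) ^ (k + Suc l))"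
    unfolding tame_tail_def
  proof (rule suminf_le[OF _ summable_tame_tail sums_summable[OF sums]])
    fix k
    have "num_tame (k + Suc l) / 4 ^ (k + Suc l) \<le> C * 2 ^ (k + Suc l) / 4 ^ (k + Suc l)"
      by (intro divide_right_mono assms) auto
    also have "\<dots> = C * (1 / 2) ^ (k + Suc l)"
      by (simp add: power_divide[symmetric] del: power_Suc add_Suc_right flip: times_divide_eq_right)
    finally show "num_tame (k + Suc l) / 4 ^ (k + Suc l) \<le> C * (1 / 2) ^ (k + Suc l)" .
  qed
  also have "\<dots> = C * ((1 / 2) ^ Suc l / (1 - 1 / 2))"
    using sums by (rule sums_unique[symmetric])
  also have "\<dots> = C / 2 ^ l"
    by (simp add: power_divide)
  finally show ?thesis .
qed

section \<open>Numerical value of the density\<close>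

lemma num_tame_3: "num_tame 3 = 1"
  by (simp add: num_tame_def card_tame_3)

lemma num_tame_4: "num_tame 4 = 1"
  using num_tame_even[of 2] by (simp add: num_tame_less_3 atMost_nat_numeral)

lemma tame_density_bounds: "0.040625 \<le> tame_density" "tame_density < 0.040626"
proof -
  let ?T = num_tame
  note T3 = num_tame_3 and T4 = num_tame_4
  have T5: "?T 5 = 1" using num_tame_odd[of 2] T3 T4 by simp
  have T6: "?T 6 = 3" using num_tame_even_rec[of 2] T3 T5 by simp
  have T7: "?T 7 = 5" using num_tame_odd[of 3] T4 T6 by simp
  have T8: "?T 8 = 11" using num_tame_even_rec[of 3] T4 T7 by simp
  have T9: "?T 9 = 21" using num_tame_odd[of 4] T5 T8 by simp
  have T10: "?T 10 = 43" using num_tame_even_rec[of 4] T5 T9 by simp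
  have T11: "?T 11 = 83" using num_tame_odd[of 5] T6 T10 by simp
  have T12: "?T 12 = 169" using num_tame_even_rec[of 5] T6 T11 by simp
  have T13: "?T 13 = 333" using num_tame_odd[of 6] T7 T12 by simp
  have T14: "?T 14 = 671" using num_tame_even_rec[of 6] T7 T13 by simp
  have T15: "?T 15 = 1331" using num_tame_odd[of 7] T8 T14 by simp
  have T16: "?T 16 = 2673" using num_tame_even_rec[of 7] T8 T15 by simp
  have T17: "?T 17 = 5325" using num_tame_odd[of 8] T9 T16 by simp
  have T18: "?T 18 = 10671" using num_tame_even_rec[of 8] T9 T17 by simp
  have T19: "?T 19 = 21299" using num_tame_odd[of 9] T10 T18 by simp
  have T20: "?T 20 = 42641" using num_tame_even_rec[of 9] T10 T19 by simp
  \<comment> \<open>Beyond the computed terms the share of framed words bounds the share of tame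
    ones; the tail is then at most 2^(-24), about 6e-8.\<close>
  have quarter: "?T k \<le> 1 / 16 * 2 ^ k" if "20 < k" for k
  proof -
    have "0 \<le> (\<Sum>j\<le>k div 2. ?T j / 4 ^ j)"
      by (intro sum_nonneg) (simp add: num_tame_nonneg)
    hence "2 ^ k * (1 / 16 - (\<Sum>j\<le>k div 2. ?T j / 4 ^ j)) \<le> 2 ^ k * (1 / 16)"
      by (intro mult_left_mono) auto
    moreover have "?T k \<le> 2 ^ k * (1 / 16 - (\<Sum>j\<le>k div 2. ?T j / 4 ^ j))"
      using num_tame_rec[of k] that num_tame_nonneg[of "Suc k div 2"] by (cases "odd k") simp_all
    ultimately show ?thesis by linarith
  qed
  have "tame_tail 20 \<le> 1 / 16 / 2 ^ 20"
    using quarter by (rule tame_tail_le)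
  \<comment> \<open>Subtracted from 1/16 this leaves about 0.04062586, farther from both bounds than
    the size of the tail.\<close>
  moreover have "(\<Sum>k\<le>20. ?T k / 4 ^ k) = 24050871949 / 1099511627776"
    by (simp add: atMost_nat_numeral num_tame_less_3 T3 T4 T5 T6 T7 T8 T9 T10 T11 T12 T13 T14 T15
        T16 T17 T18 T19 T20)
  ultimately show "0.040625 \<le> tame_density" "tame_density < 0.040626"
    using tame_density_split[of 20] tame_tail_nonneg[of 20] by simp_all
qed

section \<open>Error terms for the number of tame words\<close>

definition tame_error :: "nat \<Rightarrow> real" where
  "tame_error m = num_tame m - tame_density * 2 ^ m"

lemma power2_double: "(2 :: real) ^ (2 * l) = 4 ^ l"
  by (simp add: power_mult)

lemma tame_error_even:
  "2 \<le> l \<Longrightarrow> tame_error (2 * l) = 4 ^ l * tame_tail l"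
  unfolding tame_error_def num_tame_even tame_density_split power2_double by (simp add: distrib_left)

lemma tame_error_odd:
  assumes "2 \<le> l"
  shows "tame_error (2 * l + 1) = 2 * 4 ^ l * tame_tail l - num_tame (l + 1)"
  unfolding tame_error_def num_tame_odd[OF assms] num_tame_even[OF assms] tame_density_split
    power_add power2_double by (simp add: distrib_left)

text \<open>First, crude estimate: the trivial bound on the tail gives order 2^(m/2). The constant 8
  also covers m < 4, where 2^m \<le> 8.\<close>

lemma tame_error_le: "\<bar>tame_error m\<bar> \<le> 8 * sqrt 2 ^ m"
proof (cases "4 \<le> m")
  case True
  define l where "l = m div 2"
  have l: "2 \<le> l" "m = 2 * l \<or> m = 2 * l + 1"
    using True unfolding l_def by presburger+
  have tail: "tame_tail l \<le> 1 / 2 ^ l"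
    using num_tame_le by (intro tame_tail_le) simp
  have "4 ^ l * tame_tail l \<le> 4 ^ l * (1 / 2 ^ l)"
    using tail by (intro mult_left_mono) auto
  also have "\<dots> = (4 / 2) ^ l"
    by (simp only: power_divide) simp
  finally have ub: "4 ^ l * tame_tail l \<le> 2 ^ l" by simp
  have lb: "0 \<le> 4 ^ l * tame_tail l"
    using tame_tail_nonneg by simp
  have sq: "sqrt 2 ^ (2 * l) = 2 ^ l"
    by (simp add: power_mult)
  from l(2) show ?thesis
  proof
    assume m: "m = 2 * l"
    have "\<bar>tame_error m\<bar> \<le> 2 ^ l"
      unfolding m tame_error_even[OF l(1)] using ub lb by simp
    thus ?thesis unfolding m sq by simp
  next
    assume m: "m = 2 * l + 1"
    have "\<bar>tame_error m\<bar> \<le> 2 * 2 ^ l"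
      unfolding m tame_error_odd[OF l(1)]
      using ub lb num_tame_le[of "l + 1"] num_tame_nonneg[of "l + 1"] by simp
    also have "\<dots> \<le> 2 ^ l * (8 * sqrt 2)"
    proof -
      have "1 \<le> sqrt 2" by simp
      hence "2 \<le> 8 * sqrt 2" by linarith
      thus ?thesis by simp
    qed
    finally show ?thesis unfolding m power_add sq by simp
  qed
next
  case False
  have "\<bar>tame_error m\<bar> \<le> 2 ^ m"
  proof -
    have "0 \<le> tame_density * 2 ^ m" "tame_density * 2 ^ m \<le> 1 * 2 ^ m"
      using tame_density_bounds by (intro mult_nonneg_nonneg mult_right_mono; simp)+
    thus ?thesis
      unfolding tame_error_def using num_tame_le[of m] num_tame_nonneg[of m] by linarith
  qed
  also have "(2::real) ^ m \<le> 2 ^ 3"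
    using False by (intro power_increasing) auto
  also have "\<dots> \<le> 8 * sqrt 2 ^ m"
    by (simp add: one_le_power)
  finally show ?thesis .
qed

text \<open>
  Feeding the error bound of order \<open>2^(m/2)\<close> back into the tail, which only involves
  words of length above \<open>m/2\<close>, improves it to order \<open>2^(m/4)\<close>.
\<close>

lemma tame_tail_approx: "\<bar>tame_tail l - tame_density / 2 ^ l\<bar> \<le> 16 * (sqrt 2 / 4) ^ l"
proof -
  \<comment> \<open>The ratio of the geometric majorant that \<open>tame_error_le\<close> gives for
    \<open>tame_error j / 4 ^ j\<close>; r \<le> 1/2 keeps r / (1 - r) bounded by 1.\<close>
  define r :: real where "r = sqrt 2 / 4"
  have r: "0 \<le> r" "r \<le> 1 / 2"
    using real_sqrt_le_mono[of 2 4] by (simp_all add: r_def)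
  have geo: "(\<lambda>k. tame_density * (1 / 2) ^ (k + Suc l)) sums
      (tame_density * ((1 / 2) ^ Suc l / (1 - 1 / 2)))"
    by (intro sums_mult geometric_tail_sums) simp
  have geo_r: "(\<lambda>k. 8 * r ^ (k + Suc l)) sums (8 * (r ^ Suc l / (1 - r)))"
    using r by (intro sums_mult geometric_tail_sums) simp
  have "(\<lambda>k. num_tame (k + Suc l) / 4 ^ (k + Suc l) - tame_density * (1 / 2) ^ (k + Suc l)) sums
      (tame_tail l - tame_density * ((1 / 2) ^ Suc l / (1 - 1 / 2)))"
    unfolding tame_tail_def by (intro sums_diff summable_sums[OF summable_tame_tail] geo)
  also have "(\<lambda>k. num_tame (k + Suc l) / 4 ^ (k + Suc l) - tame_density * (1 / 2) ^ (k + Suc l)) =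
      (\<lambda>k. tame_error (k + Suc l) / 4 ^ (k + Suc l))"
  proof
    fix k
    have "(1 / 2 :: real) ^ j = 2 ^ j / 4 ^ j" for j
      by (simp flip: power_divide)
    thus "num_tame (k + Suc l) / 4 ^ (k + Suc l) - tame_density * (1 / 2) ^ (k + Suc l) =
        tame_error (k + Suc l) / 4 ^ (k + Suc l)"
      by (simp only: tame_error_def diff_divide_distrib times_divide_eq_right)
  qed
  also have "tame_density * ((1 / 2) ^ Suc l / (1 - 1 / 2)) = tame_density / 2 ^ l"
    by (simp add: power_divide)
  finally have err: "(\<lambda>k. tame_error (k + Suc l) / 4 ^ (k + Suc l)) sums (tame_tail l - tame_density / 2 ^ l)" .
  have bound: "norm (tame_error j / 4 ^ j) \<le> 8 * r ^ j" for j
  proof -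
    have "norm (tame_error j / 4 ^ j) \<le> 8 * sqrt 2 ^ j / 4 ^ j"
      using tame_error_le[of j] by (simp add: divide_right_mono)
    thus ?thesis by (simp add: r_def power_divide)
  qed
  have "norm (\<Sum>k. tame_error (k + Suc l) / 4 ^ (k + Suc l)) \<le> (\<Sum>k. 8 * r ^ (k + Suc l))"
    by (rule norm_suminf_le[OF _ sums_summable[OF geo_r]]) (rule bound)
  hence "\<bar>tame_tail l - tame_density / 2 ^ l\<bar> \<le> 8 * (r ^ Suc l / (1 - r))"
    using sums_unique[OF err] sums_unique[OF geo_r] by simp
  also have "\<dots> = 8 * (r / (1 - r)) * r ^ l"
    by simp
  also have "\<dots> \<le> 16 * r ^ l"
    using r by (intro mult_right_mono) (auto simp: field_simps)
  finally show ?thesis by (simp add: r_def)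
qed

lemma scaled_tail_approx: "\<bar>4 ^ l * tame_tail l - tame_density * 2 ^ l\<bar> \<le> 16 * sqrt 2 ^ l"
proof -
  have four: "(4::real) ^ l = 2 ^ l * 2 ^ l"
    by (simp flip: power_mult_distrib)
  have "4 ^ l * tame_tail l - tame_density * 2 ^ l = 4 ^ l * (tame_tail l - tame_density / 2 ^ l)"
    by (simp add: four field_simps)
  hence "\<bar>4 ^ l * tame_tail l - tame_density * 2 ^ l\<bar> = 4 ^ l * \<bar>tame_tail l - tame_density / 2 ^ l\<bar>"
    by (simp add: abs_mult)
  also have "\<dots> \<le> 4 ^ l * (16 * (sqrt 2 / 4) ^ l)"
    by (intro mult_left_mono tame_tail_approx) simp
  also have "\<dots> = 16 * sqrt 2 ^ l"
    by (simp add: power_divide)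
  finally show ?thesis .
qed

text \<open>The main term of the scaled tail survives here as the secondary term of order
  2^l.\<close>

lemma num_tame_even_approx:
  assumes "2 \<le> l"
  shows "\<bar>num_tame (2 * l) - tame_density * (4 ^ l + 2 ^ l)\<bar> \<le> 16 * sqrt 2 ^ l"
proof -
  have "num_tame (2 * l) - tame_density * (4 ^ l + 2 ^ l) = 4 ^ l * tame_tail l - tame_density * 2 ^ l"
    using tame_error_even[OF assms] unfolding tame_error_def power2_double by (simp add: distrib_left)
  thus ?thesis using scaled_tail_approx[of l] by simp
qed

text \<open>Twice the scaled tail and \<open>num_tame (l + 1)\<close> have the same main term, which
  cancels, so no secondary term remains. The constant is 2 * 16 + 16, using 8 * sqrt 2 \<le>
  16.\<close>

lemma num_tame_odd_approx:
  assumes "2 \<le> l"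
  shows "\<bar>num_tame (2 * l + 1) - tame_density * (2 * 4 ^ l)\<bar> \<le> 48 * sqrt 2 ^ l"
proof -
  have "num_tame (2 * l + 1) - tame_density * (2 * 4 ^ l) = 2 * 4 ^ l * tame_tail l - num_tame (l + 1)"
    using tame_error_odd[OF assms] unfolding tame_error_def power_add power2_double by simp
  also have "\<dots> = 2 * (4 ^ l * tame_tail l - tame_density * 2 ^ l) - tame_error (l + 1)"
    by (simp add: tame_error_def algebra_simps)
  finally have eq: "num_tame (2 * l + 1) - tame_density * (2 * 4 ^ l) =
      2 * (4 ^ l * tame_tail l - tame_density * 2 ^ l) - tame_error (l + 1)" .
  have "\<bar>2 * u - v\<bar> \<le> 2 * a + b" if "\<bar>u\<bar> \<le> a" "\<bar>v\<bar> \<le> b" for u v a b :: real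
    using that by linarith
  from this[OF scaled_tail_approx tame_error_le]
  have "\<bar>num_tame (2 * l + 1) - tame_density * (2 * 4 ^ l)\<bar> \<le>
      2 * (16 * sqrt 2 ^ l) + 8 * sqrt 2 ^ (l + 1)"
    unfolding eq .
  also have "8 * sqrt 2 ^ (l + 1) \<le> 16 * sqrt 2 ^ l"
    using real_sqrt_le_mono[of 2 4] by simp
  finally show ?thesis by simp
qed

section \<open>Transfer to the optimal strings\<close>

lemma num_optimal_num_tame: "4 \<le> n \<Longrightarrow> real (num_optimal n) = 2 * num_tame (n - 1)"
  by (simp add: num_optimal_eq num_tame_def)

text \<open>Since m = n - 1, even n meets the odd case and vice versa. The factor 2 for the last
  letter turns 2^l into 2^(n div 2 + 1) for odd n and 48 into 96; n \<ge> 6 ensures l \<ge>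
  2.\<close>

lemma num_optimal_approx:
  assumes n: "6 \<le> n"
  shows "\<bar>real (num_optimal n) -
      (if even n then tame_density * 2 ^ n else tame_density * (2 ^ n + 2 ^ (n div 2 + 1)))\<bar>
    \<le> 96 * 2 powr (real n / 4)"
proof -
  have root: "sqrt 2 ^ l \<le> 2 powr (real n / 4)" if "2 * l \<le> n" for l
  proof -
    have "sqrt 2 ^ l = (2 powr (1 / 2)) powr real l"
      by (simp add: powr_half_sqrt powr_realpow)
    also have "\<dots> = 2 powr (real l / 2)"
      by (simp add: powr_powr)
    also have "\<dots> \<le> 2 powr (real n / 4)"
      using that by (intro powr_mono) auto
    finally show ?thesis .
  qed
  show ?thesis
  proof (cases "even n")
    case True
    then obtain k where k: "n = 2 * k"
      by (elim evenE)
    define l where "l = k - 1"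
    have l: "n = 2 * l + 2" "2 \<le> l"
      using n k by (auto simp: l_def)
    have pow: "(2::real) ^ n = 4 * 4 ^ l"
      unfolding l by (simp add: power_add power_mult)
    have "real (num_optimal n) - tame_density * 2 ^ n =
        2 * (num_tame (2 * l + 1) - tame_density * (2 * 4 ^ l))"
      using l(1) n unfolding pow by (simp add: num_optimal_num_tame)
    hence "\<bar>real (num_optimal n) - tame_density * 2 ^ n\<bar> =
        2 * \<bar>num_tame (2 * l + 1) - tame_density * (2 * 4 ^ l)\<bar>"
      by (simp only: abs_mult abs_numeral)
    thus ?thesis
      using num_tame_odd_approx[OF l(2)] root[of l] l True by simp
  next
    case False
    then obtain l where l: "n = 2 * l + 1"
      by (elim oddE)
    have pow: "(2::real) ^ n = 2 * 4 ^ l"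
      unfolding l by (simp add: power_mult)
    have "real (num_optimal n) - tame_density * (2 ^ n + 2 ^ (n div 2 + 1)) =
        2 * (num_tame (2 * l) - tame_density * (4 ^ l + 2 ^ l))"
      using l n unfolding pow by (simp add: num_optimal_num_tame algebra_simps)
    hence "\<bar>real (num_optimal n) - tame_density * (2 ^ n + 2 ^ (n div 2 + 1))\<bar> =
        2 * \<bar>num_tame (2 * l) - tame_density * (4 ^ l + 2 ^ l)\<bar>"
      by (simp only: abs_mult abs_numeral)
    moreover have "2 \<le> l" using l n by simp
    ultimately show ?thesis
      using num_tame_even_approx[of l] root[of l] l False by simp
  qed
qed

lemma num_optimal_density: "(\<lambda>n. real (num_optimal n) / 2 ^ n) \<longlonglongrightarrow> tame_density"
proof -
  have "(\<lambda>m. num_tame m / 2 ^ m - tame_density) \<longlonglongrightarrow> 0"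
  proof (rule Lim_null_comparison)
    show "\<forall>\<^sub>F m in sequentially. norm (num_tame m / 2 ^ m - tame_density) \<le> 8 * (sqrt 2 / 2) ^ m"
    proof (intro always_eventually allI)
      fix m
      have "num_tame m / 2 ^ m - tame_density = tame_error m / 2 ^ m"
        by (simp add: tame_error_def diff_divide_distrib)
      hence "norm (num_tame m / 2 ^ m - tame_density) = \<bar>tame_error m\<bar> / 2 ^ m"
        by simp
      also have "\<dots> \<le> 8 * sqrt 2 ^ m / 2 ^ m"
        by (intro divide_right_mono tame_error_le) simp
      finally show "norm (num_tame m / 2 ^ m - tame_density) \<le> 8 * (sqrt 2 / 2) ^ m"
        by (simp add: power_divide)
    qed
    have "sqrt 2 / 2 < 1"
      using real_sqrt_less_mono[of 2 4] by simp
    thus "(\<lambda>m. 8 * (sqrt 2 / 2) ^ m) \<longlonglongrightarrow> 0"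
      by (intro tendsto_mult_right_zero LIMSEQ_power_zero) simp
  qed
  hence "(\<lambda>m. num_tame m / 2 ^ m) \<longlonglongrightarrow> tame_density"
    by (simp add: LIM_zero_iff)
  moreover have "\<forall>\<^sub>F m in sequentially. num_tame m / 2 ^ m = real (num_optimal (Suc m)) / 2 ^ Suc m"
    using eventually_ge_at_top[of 3] by eventually_elim (simp add: num_optimal_num_tame)
  ultimately have "(\<lambda>m. real (num_optimal (Suc m)) / 2 ^ Suc m) \<longlonglongrightarrow> tame_density"
    by (rule Lim_transform_eventually)
  thus ?thesis by (rule LIMSEQ_imp_Suc)
qed

theorem theorem1p2:
  shows "\<exists>\<alpha>::real. 0 < \<alpha> \<and> 0.040625 \<le> \<alpha> \<and> \<alpha> < 0.040626 \<and>
    (\<lambda>n. real (num_optimal n) -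
        (if even n then \<alpha> * 2 ^ n else \<alpha> * (2 ^ n + 2 ^ (n div 2 + 1))))
      \<in> O(\<lambda>n. 2 powr (real n / 4)) \<and>
    (\<lambda>n. real (num_optimal n) / 2 ^ n) \<longlonglongrightarrow> \<alpha>"
proof (intro exI[of _ tame_density] conjI)
  show "0 < tame_density"
    using tame_density_bounds by simp
  show "(\<lambda>n. real (num_optimal n) -
      (if even n then tame_density * 2 ^ n else tame_density * (2 ^ n + 2 ^ (n div 2 + 1))))
    \<in> O(\<lambda>n. 2 powr (real n / 4))"
  proof (rule bigoI)
    show "\<forall>\<^sub>F n in sequentially. norm (real (num_optimal n) -
        (if even n then tame_density * 2 ^ n else tame_density * (2 ^ n + 2 ^ (n div 2 + 1))))
      \<le> 96 * norm (2 powr (real n / 4))"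
      using eventually_ge_at_top[of 6]
    proof eventually_elim
      case (elim n)
      have "norm (2 powr (real n / 4)) = 2 powr (real n / 4)"
        by simp
      thus ?case using num_optimal_approx[OF elim] by (simp only: real_norm_def)
    qed
  qed
qed (use tame_density_bounds num_optimal_density in auto)

end
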